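(* Let $k$ be an algebraically closed field of characteristic zero, $R = k[x_1,x_2,x_3,x_4]$, $d \geq 2$, let $I \subset R$ be an ideal generated by a regular sequence of four forms of degree $d$, and let $A = R/I$. Let $Z \subset H \cong \mathbb{P}^2$ be the associated general hyperplane section (see context) with $h$-vector $\Delta h_Z$. Then $A$ has the Weak Lefschetz Property if and only if \[ \Delta h_Z(t) = t+1 \ \text{ for } 0 \leq t \leq 2d-2, \qquad \Delta h_Z(2d-1) = d, \qquad \Delta h_Z(t) = 0 \ \text{ for } t \geq 2d . \]
   Context: Setup: $V_1, V_2 \subset [I]_d$ are general $2$-dimensional subspaces of the $4$-dimensional space $[I]_d$, $C_i \subset \mathbb{P}^3$ is the complete intersection curve with ideal $I_i = \langle V_i \rangle$ (smooth, irreducible, and $C_1 \cap C_2 = \emptyset$), $C = C_1 \cup C_2$, $L$ is a general linear form defining a plane $H$, and $Z = C \cap H$. "General" means in a suitable nonempty Zariski-open subset of the parameter space. Let $S = R/\langle L\rangle$ be the coordinate ring of $H$ and $I_Z \subset S$ the saturated ideal of $Z$ in $H$. Put $h_Z(t) = \dim_k [S/I_Z]_t$; the $h$-vector is $\Delta h_Z(t) = h_Z(t) - h_Z(t-1)$. $A$ has the Weak Lefschetz Property (WLP) if, for a general linear form $L$, $\times L : [A]_t \rightarrow [A]_{t+1}$ has maximal rank for all $t$. *)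

theory Defs
  imports
    "HOL-Library.Poly_Mapping"
    "HOL-Library.Numeral_Type"
    "HOL-Computational_Algebra.Polynomial"
begin

text \<open>
  A polynomial with coefficients in \<open>'k\<close> and variables indexed by the finite type \<open>'i\<close> is a finitely
  supported map from exponent vectors to coefficients; the product of \<^type>\<open>poly_mapping\<close> is the
  convolution product, i.e. the product of polynomials.
\<close>

type_synonym ('i, 'k) mpoly = "('i \<Rightarrow>\<^sub>0 nat) \<Rightarrow>\<^sub>0 'k"

definition smul :: "'k::comm_ring_1 \<Rightarrow> ('i, 'k) mpoly \<Rightarrow> ('i, 'k) mpoly" where
  "smul c p = Poly_Mapping.single 0 c * p"

definition eval_mpoly :: "('i::finite, 'k::comm_ring_1) mpoly \<Rightarrow> ('i \<Rightarrow> 'k) \<Rightarrow> 'k" where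
  "eval_mpoly p a = (\<Sum>m\<in>Poly_Mapping.keys p. Poly_Mapping.lookup p m * (\<Prod>i\<in>UNIV. a i ^ Poly_Mapping.lookup m i))"

text \<open>\<open>homog t\<close> is the graded piece \<open>[R]\<^sub>t\<close>; it contains 0.\<close>

definition homog :: "nat \<Rightarrow> ('i::finite, 'k::comm_ring_1) mpoly set" where
  "homog t = {p. \<forall>m\<in>Poly_Mapping.keys p. (\<Sum>i\<in>UNIV. Poly_Mapping.lookup m i) = t}"

definition linear_form :: "('i::finite \<Rightarrow> 'k::comm_ring_1) \<Rightarrow> ('i, 'k) mpoly" where
  "linear_form l = (\<Sum>i\<in>UNIV. smul (l i) (Poly_Mapping.single (Poly_Mapping.single i 1) 1))"


subsection \<open>Vector spaces and ideals\<close>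

text \<open>
  The prefix \<open>vs\<close> refers to the structure of \<open>k\<close>-vector space, the prefix \<open>ideal\<close> to the structure of a
  ring as a module over itself: its submodules are the ideals, and \<open>ideal.span B\<close> is the ideal
  generated by \<open>B\<close>.
\<close>

interpretation vs: vector_space "smul :: 'k::field \<Rightarrow> ('i, 'k) mpoly \<Rightarrow> ('i, 'k) mpoly"
  by standard
    (simp_all add: smul_def algebra_simps single_add mult_single flip: mult.assoc)

interpretation ideal: module "(*) :: 'a::comm_ring_1 \<Rightarrow> 'a \<Rightarrow> 'a"
  by standard (simp_all add: algebra_simps)

text \<open>
  Quotients of \<open>R\<close> are handled through representatives: for a finite-dimensional subspace \<open>W\<close> and an
  ideal \<open>J\<close> of \<open>R\<close>, \<open>dim_mod W J\<close> is the dimension of the image of \<open>W\<close> in \<open>R/J\<close>, that is of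
  \<open>W / (W \<inter> J)\<close>. In particular \<open>hilbert J t\<close> is the dimension of \<open>[R/J]\<^sub>t\<close>.
\<close>

definition dim_mod :: "('i, 'k::field) mpoly set \<Rightarrow> ('i, 'k) mpoly set \<Rightarrow> nat" where
  "dim_mod W J = vs.dim W - vs.dim (W \<inter> J)"

definition hilbert :: "('i::finite, 'k::field) mpoly set \<Rightarrow> nat \<Rightarrow> nat" where
  "hilbert J t = dim_mod (homog t) J"

definition h_vector :: "('i::finite, 'k::field) mpoly set \<Rightarrow> nat \<Rightarrow> int" where
  "h_vector J t = int (hilbert J t) - (if t = 0 then 0 else int (hilbert J (t - 1)))"

definition regular_sequence :: "'a::comm_ring_1 list \<Rightarrow> bool" where
  "regular_sequence fs \<longleftrightarrow>
     ideal.span (set fs) \<noteq> UNIV \<and>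
     (\<forall>i<length fs. \<forall>p. p * fs ! i \<in> ideal.span (set (take i fs)) \<longrightarrow> p \<in> ideal.span (set (take i fs)))"

text \<open>Saturation with respect to the irrelevant ideal \<open>\<mm>\<close>; note that \<open>homog n\<close> generates \<open>\<mm>\<^sup>n\<close>.\<close>

definition saturation :: "('i::finite, 'k::comm_ring_1) mpoly set \<Rightarrow> ('i, 'k) mpoly set" where
  "saturation J = {p. \<exists>n. \<forall>q\<in>homog n. q * p \<in> J}"


subsection \<open>Zariski topology\<close>

definition zariski_open :: "('i::finite \<Rightarrow> 'k::comm_ring_1) set \<Rightarrow> bool" where
  "zariski_open U \<longleftrightarrow> (\<exists>P :: ('i, 'k) mpoly set. - U = {a. \<forall>p\<in>P. eval_mpoly p a = 0})"

definition grassmannian :: "nat \<Rightarrow> ('i, 'k::field) mpoly set \<Rightarrow> ('i, 'k) mpoly set set" where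
  "grassmannian r W = {V. vs.subspace V \<and> V \<subseteq> W \<and> vs.dim V = r}"

text \<open>
  \<open>frame_form b a j\<close> is the form whose coordinates with respect to the basis \<open>b\<close> are row \<open>j\<close> of \<open>a\<close>.
\<close>

definition frame_form ::
  "(4 \<Rightarrow> ('i::finite, 'k::field) mpoly) \<Rightarrow> (4 \<times> 4 + 'i \<Rightarrow> 'k) \<Rightarrow> 4 \<Rightarrow> ('i, 'k) mpoly" where
  "frame_form b a j = (\<Sum>i\<in>UNIV. smul (a (Inl (j, i))) (b i))"

text \<open>
  A triple consisting of two planes in the vector space with basis \<open>b\<close> and a linear form is described
  by a point of affine space: rows 0, 1 and rows 2, 3 of a \<open>4 \<times> 4\<close> matrix span the two planes, the
  remaining coordinates are the coefficients of the linear form.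
\<close>

definition triple_of ::
  "(4 \<Rightarrow> ('i::finite, 'k::field) mpoly) \<Rightarrow> (4 \<times> 4 + 'i \<Rightarrow> 'k) \<Rightarrow>
     ('i, 'k) mpoly set \<times> ('i, 'k) mpoly set \<times> ('i, 'k) mpoly" where
  "triple_of b a =
     (vs.span {frame_form b a 0, frame_form b a 1},
      vs.span {frame_form b a 2, frame_form b a 3},
      linear_form (\<lambda>i. a (Inr i)))"

text \<open>
  The Zariski topology on \<open>Gr(2, W) \<times> Gr(2, W) \<times> ([R]\<^sub>1 \<setminus> 0)\<close>, where \<open>b\<close> is a basis of \<open>W\<close>. A Grassmannian
  carries the quotient topology of its open set of frames, so a set of triples is open iff its
  preimage under \<open>triple_of b\<close> is. Degenerate frames are never in that preimage, their span being of
  dimension less than 2; as nondegenerate frames form an open set, openness of the preimage may be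
  tested in the full affine space. The topology does not depend on the choice of the basis.
\<close>

definition zariski_open_triples ::
  "(4 \<Rightarrow> ('i::finite, 'k::field) mpoly) \<Rightarrow>
     (('i, 'k) mpoly set \<times> ('i, 'k) mpoly set \<times> ('i, 'k) mpoly) set \<Rightarrow> bool" where
  "zariski_open_triples b U \<longleftrightarrow>
     U \<subseteq> grassmannian 2 (vs.span (range b)) \<times> grassmannian 2 (vs.span (range b)) \<times> (homog 1 - {0}) \<and>
     zariski_open {a. triple_of b a \<in> U}"


subsection \<open>The weak Lefschetz property and the hyperplane section\<close>

text \<open>The multiplication by \<open>L\<close> from \<open>[R/J]\<^sub>t\<close> to \<open>[R/J]\<^sub>t\<^sub>+\<^sub>1\<close> has rank equal to the smaller dimension.\<close>

definition maximal_rank :: "('i::finite, 'k::field) mpoly set \<Rightarrow> ('i, 'k) mpoly \<Rightarrow> nat \<Rightarrow> bool" where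
  "maximal_rank J L t \<longleftrightarrow>
     dim_mod ((\<lambda>p. L * p) ` homog t) J = min (hilbert J t) (hilbert J (t + 1))"

definition weak_lefschetz :: "('i::finite, 'k::field) mpoly set \<Rightarrow> bool" where
  "weak_lefschetz J \<longleftrightarrow>
     (\<exists>U :: ('i \<Rightarrow> 'k) set. zariski_open U \<and> U \<noteq> {} \<and>
        (\<forall>l\<in>U. \<forall>t. maximal_rank J (linear_form l) t))"

text \<open>
  The curve \<open>C = C\<^sub>1 \<union> C\<^sub>2\<close> has ideal \<open>\<langle>V\<^sub>1\<rangle> \<inter> \<langle>V\<^sub>2\<rangle>\<close>. The saturated ideal of \<open>Z = C \<inter> H\<close> in
  \<open>S = R/\<langle>L\<rangle>\<close> is represented by its preimage in \<open>R\<close>, which is the saturation of \<open>I\<^sub>C + \<langle>L\<rangle>\<close> and contains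
  \<open>L\<close>; hence \<open>S/I\<^sub>Z = R / section_ideal V1 V2 L\<close> as graded algebras.
\<close>

definition curve_ideal :: "('i, 'k::field) mpoly set \<Rightarrow> ('i, 'k) mpoly set \<Rightarrow> ('i, 'k) mpoly set" where
  "curve_ideal V1 V2 = ideal.span V1 \<inter> ideal.span V2"

definition section_ideal ::
  "('i::finite, 'k::field) mpoly set \<Rightarrow> ('i, 'k) mpoly set \<Rightarrow> ('i, 'k) mpoly \<Rightarrow> ('i, 'k) mpoly set" where
  "section_ideal V1 V2 L = saturation (ideal.span (curve_ideal V1 V2 \<union> {L}))"

end

theory Submission
  imports Defs
begin

text \<open>
  Let \<open>J\<^sub>i = \<langle>V\<^sub>i, L\<rangle>\<close>. As \<open>\<langle>V\<^sub>1\<rangle> + \<langle>V\<^sub>2\<rangle> = I\<close> contains a power of the irrelevant ideal, the saturated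
  ideal of \<open>Z\<close> is \<open>J\<^sub>1 \<inter> J\<^sub>2\<close>, so that \<open>h\<^sub>Z\<close> is the sum of the Hilbert functions of the two plane
  complete intersections \<open>R/J\<^sub>i\<close> of type \<open>(d, d)\<close> minus the Hilbert function of \<open>R/\<langle>I, L\<rangle> = A/LA\<close>.
  The condition on \<open>\<Delta>h\<^sub>Z\<close> thus prescribes the Hilbert function of \<open>A/LA\<close>, and the prescribed value is
  the minimal one, attained exactly when \<open>L\<close> has maximal rank on \<open>A\<close> in all degrees.

  A triple is taken to be general if \<open>V\<^sub>1 + V\<^sub>2\<close> has dimension 4, if \<open>R/\<langle>V\<^sub>i, L, x\<^sub>1\<rangle>\<close> has the Hilbert function of
  a complete intersection (which forces \<open>V\<^sub>i, L, x\<^sub>1\<close> to be a regular sequence), and if \<open>L\<close> has maximal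
  rank on \<open>A\<close> in case some linear form has. These are bounds on ranks in finitely many degrees, hence
  open conditions. A triple satisfying the second one is found on the line \<open>x\<^sub>0 = x\<^sub>1 = 0\<close>, on which two
  general members of \<open>[I]\<^sub>d\<close> have no common zero.
\<close>

text \<open>That \<open>V_i, L\<close> is a complete intersection and that \<open>J_i\<close> is
  saturated are statements about all degrees, so neither is visibly open. Adding the fixed form
  \<open>x_1\<close> settles both. The quotient becomes zero in degree \<open>2d - 1\<close> and
  stays zero, so an upper bound on its Hilbert function up to that degree is a bound in every
  degree. And regularity of \<open>x_1\<close> modulo \<open>J_i\<close> allows powers of
  \<open>x_1\<close> to be cancelled, which gives saturation. The Lefschetz test ends in the same
  degree: the first difference of the Hilbert function of \<open>A\<close>, which predicts the
  dimension of \<open>A/LA\<close>, is nonnegative up to degree \<open>2d - 2\<close> and equals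
  \<open>-d\<close> in degree \<open>2d - 1\<close>, so the last thing to check is that
  \<open>A/LA\<close> vanishes there. No single triple satisfying all the conditions is exhibited:
  each condition has its own witness, and nonempty Zariski open subsets of an affine space over an
  infinite field meet. If \<open>A\<close> lacks the property, no linear form attains the minimal
  Hilbert function, and so the condition on the h-vector fails at every triple that meets the other
  conditions.\<close>

subsection \<open>Finite-dimensional subspaces\<close>

text \<open>
  A copy of \<^locale>\<open>vector_space\<close>: a constant defined in the original locale would be hidden by its
  instance for real vector spaces.
\<close>

locale abstract_vector_space = vector_space
begin

definition fin_dim :: "'b set \<Rightarrow> bool" where
  "fin_dim W \<longleftrightarrow> (\<exists>B. finite B \<and> W \<subseteq> span B)"

lemma fin_dim_mono: "fin_dim W \<Longrightarrow> V \<subseteq> W \<Longrightarrow> fin_dim V"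
  unfolding fin_dim_def by blast

lemma fin_dim_basis:
  assumes "fin_dim W"
  obtains B where "finite B" "B \<subseteq> W" "independent B" "W \<subseteq> span B" "card B = dim W"
proof -
  obtain B where B: "B \<subseteq> W" "independent B" "W \<subseteq> span B" "card B = dim W"
    by (rule basis_exists)
  obtain S where "finite S" "W \<subseteq> span S"
    using assms fin_dim_def by blast
  then have "finite B"
    using independent_span_bound[of S B] B by auto
  then show ?thesis using that B by blast
qed

lemma card_le_dim:
  assumes "fin_dim W" "independent B" "B \<subseteq> W"
  shows "finite B" "card B \<le> dim W"
proof -
  obtain C where C: "finite C" "W \<subseteq> span C" "card C = dim W"
    by (rule fin_dim_basis[OF assms(1)])
  then have "B \<subseteq> span C" using assms(3) by blast
  then show "finite B" "card B \<le> dim W"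
    using independent_span_bound[OF C(1) assms(2)] C(3) by auto
qed

lemma fin_dim_le:
  assumes "fin_dim W" "V \<subseteq> W"
  shows "dim V \<le> dim W"
  by (metis assms basis_exists card_le_dim(2) order_trans)

lemma subspace_eqI:
  assumes "fin_dim W" "subspace V" "V \<subseteq> W" "dim W \<le> dim V"
  shows "V = W"
proof (rule ccontr)
  assume "V \<noteq> W"
  then obtain x where x: "x \<in> W" "x \<notin> V" using assms by blast
  obtain B where B: "finite B" "B \<subseteq> V" "independent B" "V \<subseteq> span B" "card B = dim V"
    by (rule fin_dim_basis[OF fin_dim_mono[OF assms(1,3)]])
  have "x \<notin> span B"
    using x B(2) assms(2) span_minimal by blast
  then have "independent (insert x B)" "x \<notin> B"
    using B independent_insertI span_base by auto
  moreover have "insert x B \<subseteq> W" using x B assms by auto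
  ultimately have "card (insert x B) \<le> dim W"
    using card_le_dim assms(1) by blast
  then show False using \<open>x \<notin> B\<close> B assms(4) by simp
qed

lemma independent_span_Int:
  assumes "independent B" "finite B" "K \<subseteq> B" "x \<in> span (B - K)" "x \<in> span K"
  shows "x = 0"
proof -
  have fK: "finite K" "finite (B - K)" using assms finite_subset by auto
  obtain u where u: "x = (\<Sum>v\<in>B - K. scale (u v) v)"
    using assms(4) span_finite[OF fK(2)] by auto
  obtain w where w: "x = (\<Sum>v\<in>K. scale (w v) v)"
    using assms(5) span_finite[OF fK(1)] by auto
  define c where "c v = (if v \<in> K then w v else - u v)" for v
  have "(\<Sum>v\<in>B. scale (c v) v) = (\<Sum>v\<in>B - K. scale (c v) v) + (\<Sum>v\<in>K. scale (c v) v)"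
    using assms by (simp add: sum.subset_diff)
  also have "(\<Sum>v\<in>B - K. scale (c v) v) = - x"
    unfolding u c_def by (simp add: sum_negf)
  also have "(\<Sum>v\<in>K. scale (c v) v) = x"
    unfolding w c_def by simp
  finally have "(\<Sum>v\<in>B. scale (c v) v) = 0" by simp
  then have "c v = 0" if "v \<in> B" for v
    using independentD[OF assms(1,2) subset_refl, of c v] that by simp
  then have "\<forall>v\<in>K. w v = 0" using assms(3) unfolding c_def by (metis subsetD)
  then show ?thesis unfolding w by simp
qed

lemma rank_nullity:
  assumes g: "module_hom scale scale g" and W: "subspace W" "fin_dim W"
  shows "dim W = dim (g ` W) + dim {x\<in>W. g x = 0}"
proof -
  interpret g: module_hom scale scale g by fact
  interpret vp: vector_space_pair scale scale by unfold_locales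
  let ?N = "{x\<in>W. g x = 0}"
  obtain K where K: "K \<subseteq> ?N" "independent K" "?N \<subseteq> span K" "card K = dim ?N"
    by (rule basis_exists)
  obtain B where B: "K \<subseteq> B" "B \<subseteq> W" "independent B" "W \<subseteq> span B"
    using maximal_independent_subset_extend[of K W] K by auto
  have finB: "finite B" using card_le_dim W B by blast
  have cB: "card B = dim W" using B basis_card_eq_dim by blast
  have inj: "inj_on g (span (B - K))"
  proof (rule inj_onI)
    fix x y assume xy: "x \<in> span (B - K)" "y \<in> span (B - K)" "g x = g y"
    have "span (B - K) \<subseteq> W"
      using B W by (meson Diff_subset order_trans span_minimal)
    then have "x - y \<in> ?N"
      using xy W(1) by (auto simp: g.diff intro: subspace_diff)
    then have "x - y \<in> span K" using K by blast
    moreover have "x - y \<in> span (B - K)" using xy by (intro span_diff)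
    ultimately have "x - y = 0"
      using independent_span_Int B finB by blast
    then show "x = y" by simp
  qed
  have "independent (g ` (B - K))"
    using B(3) inj by (intro g.independent_injective_image independent_mono[OF B(3)]) auto
  moreover have "g ` W \<subseteq> span (g ` (B - K))"
  proof
    fix y assume "y \<in> g ` W"
    then obtain x where x: "x \<in> span B" "y = g x" using B by blast
    have "span B = span ((B - K) \<union> K)" using B by (simp add: Un_absorb2)
    then obtain a b where ab: "x = a + b" "a \<in> span (B - K)" "b \<in> span K"
      using x(1) unfolding span_Un by blast
    have "g b = 0"
      by (rule g.eq_0_on_span[OF _ ab(3)]) (use K in auto)
    then show "y \<in> span (g ` (B - K))"
      using x ab by (auto simp: g.add g.span_image)
  qed
  moreover have "g ` (B - K) \<subseteq> g ` W" using B by auto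
  ultimately have "dim (g ` W) = card (g ` (B - K))"
    using basis_card_eq_dim by metis
  also have "\<dots> = card (B - K)"
    by (intro card_image inj_on_subset[OF inj] span_superset)
  also have "\<dots> = card B - card K"
    using B finB by (meson card_Diff_subset finite_subset)
  finally show ?thesis using K cB card_mono[OF finB B(1)] by simp
qed

text \<open>The projection along a complement of \<open>J\<close> stands in for the quotient map, so
  that counting modulo \<open>J\<close> becomes rank and nullity inside the same space.\<close>

lemma exists_linear_with_kernel:
  assumes "subspace J"
  shows "\<exists>g. module_hom scale scale g \<and> {x. g x = 0} = J"
proof -
  interpret vp: vector_space_pair scale scale by unfold_locales
  obtain K where K: "K \<subseteq> J" "independent K" "J \<subseteq> span K"
    by (rule basis_exists)
  obtain B where B: "K \<subseteq> B" "independent B" "UNIV \<subseteq> span B"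
    using maximal_independent_subset_extend[of K UNIV] K by auto
  define g where "g = vp.construct B (\<lambda>b. if b \<in> K then 0 else b)"
  have lin: "module_hom scale scale g"
    unfolding g_def using vp.linear_construct[OF B(2)] by (simp add: linear_iff_module_hom)
  interpret g: module_hom scale scale g by fact
  have gK: "g b = 0" if "b \<in> K" for b
    using that B vp.construct_basis[OF B(2)] unfolding g_def by auto
  have gB: "g b = b" if "b \<in> B - K" for b
    using that B vp.construct_basis[OF B(2)] unfolding g_def by auto
  have spK: "g b = 0" if "b \<in> span K" for b
    by (rule g.eq_0_on_span[OF _ that]) (use gK in auto)
  have spB: "g a = a" if "a \<in> span (B - K)" for a
    using that
    by (induction rule: span_induct_alt) (auto simp: g.add g.scale gB)
  have "x \<in> J" if "g x = 0" for x
  proof -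
    have "span B = span ((B - K) \<union> K)" using B by (simp add: Un_absorb2)
    then obtain a b where ab: "x = a + b" "a \<in> span (B - K)" "b \<in> span K"
      using B(3) unfolding span_Un by blast
    then have "a = 0" using that spK spB by (simp add: g.add)
    then show ?thesis using ab span_minimal[OF K(1) assms] by auto
  qed
  then have "{x. g x = 0} = J" using K spK by blast
  then show ?thesis using lin by blast
qed

text \<open>Rank-nullity is applied twice, to \<open>p \<circ> g\<close> on \<open>W\<close> and to
  \<open>p\<close> on the image of \<open>W\<close>, where \<open>p\<close> has kernel
  \<open>J\<close>. Eliminating the dimension of the common image gives the identity.\<close>

lemma dim_image_mod:
  assumes g: "module_hom scale scale g" and W: "subspace W" "fin_dim W" and J: "subspace J"
  shows "dim (g ` W) + dim {x\<in>W. g x \<in> J} = dim W + dim (g ` W \<inter> J)"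
proof -
  obtain p where p: "module_hom scale scale p" "{x. p x = 0} = J"
    using exists_linear_with_kernel[OF J] by blast
  interpret g: module_hom scale scale g by fact
  have pJ: "p x = 0 \<longleftrightarrow> x \<in> J" for x using p(2) by blast
  obtain S where S: "finite S" "W \<subseteq> span S" using W fin_dim_def by blast
  have gW: "subspace (g ` W)" "fin_dim (g ` W)"
    using g.subspace_image[OF W(1)] finite_imageI[OF S(1), of g] g.spans_image[OF S(2)]
    unfolding fin_dim_def by (blast, blast)
  have "dim W = dim ((p \<circ> g) ` W) + dim {x\<in>W. g x \<in> J}"
    using rank_nullity[OF module_hom_compose[OF g p(1)] W] by (simp add: pJ)
  moreover have "dim (g ` W) = dim (p ` g ` W) + dim {x\<in>g ` W. p x = 0}"
    using rank_nullity[OF p(1) gW] .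
  moreover have "{x\<in>g ` W. p x = 0} = g ` W \<inter> J" using pJ by blast
  ultimately show ?thesis by (simp add: image_comp)
qed

text \<open>A linear map with kernel \<open>A\<close> has the same image on \<open>A + B\<close> as
  on \<open>B\<close>; its nullities there are \<open>dim A\<close> and
  \<open>dim (A \<inter> B)\<close>.\<close>

lemma dim_sums_Int:
  assumes A: "subspace A" "fin_dim A" and B: "subspace B" "fin_dim B"
  shows "dim {x + y | x y. x \<in> A \<and> y \<in> B} + dim (A \<inter> B) = dim A + dim B"
proof -
  let ?S = "{x + y | x y. x \<in> A \<and> y \<in> B}"
  obtain p where p: "module_hom scale scale p" "{x. p x = 0} = A"
    using exists_linear_with_kernel[OF A(1)] by blast
  interpret p: module_hom scale scale p by fact
  have pA: "p x = 0 \<longleftrightarrow> x \<in> A" for x using p(2) by blast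
  obtain S T where "finite S" "A \<subseteq> span S" "finite T" "B \<subseteq> span T"
    using A(2) B(2) unfolding fin_dim_def by auto
  then have "fin_dim ?S"
    unfolding fin_dim_def by (intro exI[of _ "S \<union> T"]) (auto simp: span_Un)
  then have "dim ?S = dim (p ` ?S) + dim {x\<in>?S. p x = 0}"
    using rank_nullity[OF p(1)] subspace_sums A B by blast
  moreover have "{x\<in>?S. p x = 0} = A"
    using pA subspace_0[OF B(1)] by force
  moreover have "p ` ?S = p ` B"
  proof
    have "p x = 0" if "x \<in> A" for x using pA that by blast
    then show "p ` ?S \<subseteq> p ` B" by (auto simp: p.add)
    show "p ` B \<subseteq> p ` ?S"
    proof
      fix y assume "y \<in> p ` B"
      then obtain x where "x \<in> B" "y = p x" by blast
      moreover have "0 + x \<in> ?S"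
        using subspace_0[OF A(1)] \<open>x \<in> B\<close> by blast
      ultimately show "y \<in> p ` ?S" by force
    qed
  qed
  moreover have "dim B = dim (p ` B) + dim {x\<in>B. p x = 0}"
    using rank_nullity[OF p(1) B] .
  moreover have "{x\<in>B. p x = 0} = A \<inter> B" using pA by blast
  ultimately show ?thesis by simp
qed

end

interpretation vs: abstract_vector_space "smul :: 'k::field \<Rightarrow> ('i, 'k) mpoly \<Rightarrow> ('i, 'k) mpoly" ..

thm vs.dim_sums_Int

subsection \<open>Graded pieces and homogeneous ideals\<close>

abbreviation lookup where "lookup \<equiv> Poly_Mapping.lookup"
abbreviation keys where "keys \<equiv> Poly_Mapping.keys"
abbreviation single where "single \<equiv> Poly_Mapping.single"

definition mdeg :: "('i::finite \<Rightarrow>\<^sub>0 nat) \<Rightarrow> nat" where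
  "mdeg m = (\<Sum>i\<in>UNIV. lookup m i)"

lemma mdeg_add: "mdeg (m + n) = mdeg m + mdeg n"
  by (simp add: mdeg_def lookup_add sum.distrib)

lemma mdeg_zero [simp]: "mdeg 0 = 0"
  by (simp add: mdeg_def)

lemma mdeg_single [simp]: "mdeg (single i n) = n"
  by (simp add: mdeg_def lookup_single when_def)

lemma lookup_le_mdeg: "lookup m i \<le> mdeg m"
  unfolding mdeg_def by (rule member_le_sum) auto

lemma finite_mdeg: "finite {m :: 'i::finite \<Rightarrow>\<^sub>0 nat. mdeg m = t}"
proof (rule finite_imageD)
  have "lookup ` {m :: 'i \<Rightarrow>\<^sub>0 nat. mdeg m = t} \<subseteq> {f. f ` UNIV \<subseteq> {..t}}"
    using lookup_le_mdeg by fastforce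
  moreover have "finite {f :: 'i \<Rightarrow> nat. f ` UNIV \<subseteq> {..t}}"
    using finite_set_of_finite_funs[of "UNIV :: 'i set" "{..t}" 0]
    by (simp add: image_subset_iff)
  ultimately show "finite (lookup ` {m :: 'i \<Rightarrow>\<^sub>0 nat. mdeg m = t})"
    by (rule finite_subset)
  show "inj_on lookup {m :: 'i \<Rightarrow>\<^sub>0 nat. mdeg m = t}"
    by (intro inj_onI) (simp add: poly_mapping_eqI)
qed

lemma homog_iff: "p \<in> homog t \<longleftrightarrow> (\<forall>m. lookup p m \<noteq> 0 \<longrightarrow> mdeg m = t)"
  by (auto simp: homog_def mdeg_def in_keys_iff)

lemma lookup_smul [simp]: "lookup (smul c p) m = c * lookup p m"
  unfolding smul_def by (simp add: mult_map_scale_conv_mult[symmetric] map.rep_eq when_def)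

lemma smul_mult: "smul c p * q = smul c (p * q)" "p * smul c q = smul c (p * q)"
  unfolding smul_def by (rule mult.assoc, rule mult.left_commute)

lemma smul_single: "smul c (single m a) = single m (c * a)"
  by (simp add: smul_def mult_single)

lemma subspace_homog: "vs.subspace (homog t)"
  by (rule vs.subspaceI) (auto simp: homog_iff lookup_add, metis add.right_neutral)

lemma homog_zero [simp]: "0 \<in> homog t"
  by (simp add: homog_iff)

lemma homog_add: "p \<in> homog t \<Longrightarrow> q \<in> homog t \<Longrightarrow> p + q \<in> homog t"
  by (auto simp: homog_iff lookup_add) (metis add.right_neutral)

lemma homog_single: "mdeg m = t \<Longrightarrow> single m c \<in> homog t"
  by (auto simp: homog_iff lookup_single when_def)

lemma homog_mult:
  assumes "p \<in> homog s" "q \<in> homog t"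
  shows "p * q \<in> homog (s + t)"
  using keys_mult[of p q] assms unfolding homog_def mdeg_def[symmetric]
  by (force simp: mdeg_add)

lemma poly_mapping_eq_sum_single:
  "p = (\<Sum>m\<in>keys p. single m (lookup p m))"
  by (rule poly_mapping_eqI) (auto simp: lookup_sum lookup_single when_def in_keys_iff)

lemma fin_dim_homog: "vs.fin_dim (homog t :: ('i::finite, 'k::field) mpoly set)"
  unfolding vs.fin_dim_def
proof (intro exI conjI)
  let ?B = "(\<lambda>m. single m (1::'k)) ` {m :: 'i \<Rightarrow>\<^sub>0 nat. mdeg m = t}"
  show "finite ?B" using finite_mdeg by blast
  show "homog t \<subseteq> vs.span ?B"
  proof
    fix p :: "('i, 'k) mpoly" assume p: "p \<in> homog t"
    have "(\<Sum>m\<in>keys p. single m (lookup p m)) \<in> vs.span ?B"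
    proof (rule vs.span_sum)
      fix m assume "m \<in> keys p"
      then have "mdeg m = t" using p by (simp add: homog_iff in_keys_iff)
      then have "smul (lookup p m) (single m 1) \<in> vs.span ?B"
        by (intro vs.span_scale vs.span_base) auto
      then show "single m (lookup p m) \<in> vs.span ?B"
        by (simp add: smul_single)
    qed
    then show "p \<in> vs.span ?B" using poly_mapping_eq_sum_single[of p] by simp
  qed
qed

section \<open>Homogeneous components\<close>

definition hcomp :: "nat \<Rightarrow> ('i::finite, 'k::comm_ring_1) mpoly \<Rightarrow> ('i, 'k) mpoly" where
  "hcomp t p = (\<Sum>m\<in>{m\<in>keys p. mdeg m = t}. single m (lookup p m))"

lemma lookup_hcomp: "lookup (hcomp t p) m = (if mdeg m = t then lookup p m else 0)"
proof -
  have "lookup (hcomp t p) m =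
      (\<Sum>n\<in>{n\<in>keys p. mdeg n = t}. if n = m then lookup p n else 0)"
    by (simp add: hcomp_def lookup_sum lookup_single when_def)
  also have "\<dots> = (if m \<in> {n\<in>keys p. mdeg n = t} then lookup p m else 0)"
    by (intro sum.delta) simp
  finally show ?thesis by (auto simp: in_keys_iff)
qed

lemma hcomp_add: "hcomp t (p + q) = hcomp t p + hcomp t q"
  by (rule poly_mapping_eqI) (simp add: lookup_hcomp lookup_add)

lemma hcomp_zero [simp]: "hcomp t 0 = 0"
  by (simp add: hcomp_def)

lemma hcomp_sum: "hcomp t (sum f A) = (\<Sum>x\<in>A. hcomp t (f x))"
  by (induction A rule: infinite_finite_induct) (simp_all add: hcomp_add)

lemma hcomp_in_homog [simp]: "hcomp t p \<in> homog t"
  by (simp add: homog_iff lookup_hcomp)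

lemma hcomp_homog: "p \<in> homog s \<Longrightarrow> hcomp t p = (if s = t then p else 0)"
  by (rule poly_mapping_eqI) (auto simp: lookup_hcomp homog_iff)

lemma sum_hcomp:
  assumes "\<And>m. m \<in> keys p \<Longrightarrow> mdeg m < N"
  shows "p = (\<Sum>t<N. hcomp t p)"
  using assms by (intro poly_mapping_eqI) (auto simp: lookup_sum lookup_hcomp in_keys_iff)

lemma exists_sum_hcomp: "\<exists>N. \<forall>M\<ge>N. p = (\<Sum>t<M. hcomp t p)"
proof -
  have "finite (mdeg ` keys p)" by simp
  then obtain N where N: "\<forall>n\<in>mdeg ` keys p. n < N"
    using finite_nat_set_iff_bounded by blast
  show ?thesis
    by (intro exI[of _ N] allI impI sum_hcomp) (use N in force)
qed

lemma hcomp_mult: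
  assumes g: "g \<in> homog s"
  shows "hcomp t (q * g) = (if s \<le> t then hcomp (t - s) q * g else 0)"
proof -
  \<comment> \<open>The sum is taken beyond \<open>t\<close>, so that the only summand that can
    contribute, \<open>u = t - s\<close>, is in range.\<close>
  obtain M where M: "M > t" "q = (\<Sum>u<M. hcomp u q)"
    using exists_sum_hcomp[of q] by (metis le_add1 less_add_Suc2 add_Suc_right)
  have "hcomp t (q * g) = (\<Sum>u<M. hcomp t (hcomp u q * g))"
    by (subst M(2)) (simp add: sum_distrib_right hcomp_sum)
  also have "\<dots> = (\<Sum>u<M. if u + s = t then hcomp u q * g else 0)"
    by (intro sum.cong refl, subst hcomp_homog[OF homog_mult[OF hcomp_in_homog g]]) simp
  also have "\<dots> = (if s \<le> t then hcomp (t - s) q * g else 0)"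
  proof (cases "s \<le> t")
    case True
    then have "u + s = t \<longleftrightarrow> u = t - s" for u by auto
    then show ?thesis using True M(1) by simp
  next
    case False
    then show ?thesis by (auto intro!: sum.neutral)
  qed
  finally show ?thesis .
qed

section \<open>Homogeneous ideals and their graded pieces\<close>

definition homogeneous_ideal :: "('i::finite, 'k::comm_ring_1) mpoly set \<Rightarrow> bool" where
  "homogeneous_ideal J \<longleftrightarrow> ideal.subspace J \<and> (\<forall>p\<in>J. \<forall>t. hcomp t p \<in> J)"

lemma homogeneous_ideal_hcomp: "homogeneous_ideal J \<Longrightarrow> p \<in> J \<Longrightarrow> hcomp t p \<in> J"
  by (simp add: homogeneous_ideal_def)

lemma homogeneous_ideal_ideal: "homogeneous_ideal J \<Longrightarrow> ideal.subspace J"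
  by (simp add: homogeneous_ideal_def)

lemma vs_subspace_ideal: "ideal.subspace J \<Longrightarrow> vs.subspace J"
  by (auto intro!: vs.subspaceI ideal.subspace_0 ideal.subspace_add simp: smul_def ideal.subspace_scale)

lemma homogeneous_ideal_vs: "homogeneous_ideal J \<Longrightarrow> vs.subspace J"
  by (simp add: homogeneous_ideal_def vs_subspace_ideal)

lemma homogeneous_ideal_span:
  assumes "\<And>g. g \<in> G \<Longrightarrow> \<exists>d. g \<in> homog d"
  shows "homogeneous_ideal (ideal.span G)"
  unfolding homogeneous_ideal_def
proof (intro conjI ballI allI)
  fix p t assume "p \<in> ideal.span G"
  then show "hcomp t p \<in> ideal.span G"
  proof (induction rule: ideal.span_induct_alt)
    case base
    show ?case by (simp add: ideal.span_zero)
  next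
    case (step c x y)
    obtain d where d: "x \<in> homog d" using assms step by blast
    have "hcomp t (c * x) \<in> ideal.span G"
      using step(1) by (simp add: hcomp_mult[OF d] ideal.span_zero ideal.span_scale ideal.span_base)
    then show ?case using step by (simp add: hcomp_add ideal.span_add)
  qed
qed (rule ideal.subspace_span)

text \<open>For finite \<open>X\<close> this presents a graded piece as the span of finitely many
  vectors whose coefficients are read off from the generators; bounds on its dimension thereby
  become rank conditions.\<close>

lemma ideal_span_piece:
  assumes "\<And>x. x \<in> X \<Longrightarrow> g x \<in> homog (e x)"
  shows "ideal.span (g ` X) \<inter> homog t =
         vs.span {single m 1 * g x | m x. x \<in> X \<and> mdeg m + e x = t}" (is "_ = vs.span (?G t)")
proof
  have "vs.subspace (ideal.span (g ` X) \<inter> homog t)"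
    by (intro vs.subspace_inter subspace_homog vs_subspace_ideal ideal.subspace_span)
  moreover have "?G t \<subseteq> ideal.span (g ` X) \<inter> homog t"
    using assms by (force intro!: ideal.span_scale intro: ideal.span_base homog_mult homog_single)
  ultimately show "vs.span (?G t) \<subseteq> ideal.span (g ` X) \<inter> homog t"
    by (intro vs.span_minimal)
  \<comment> \<open>The induction runs through inhomogeneous elements of the ideal, so it has to
    carry all components at once.\<close>
  have "\<forall>t. hcomp t p \<in> vs.span (?G t)" if "p \<in> ideal.span (g ` X)" for p
    using that
  proof (induction rule: ideal.span_induct_alt)
    case base
    show ?case by (simp add: vs.span_zero)
  next
    case (step c y z)
    obtain x where x: "x \<in> X" "y = g x" using step by blast
    show ?case
    proof
      fix t
      have "hcomp t (c * y) \<in> vs.span (?G t)"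
      proof (cases "e x \<le> t")
        case True
        have "(\<Sum>m\<in>keys (hcomp (t - e x) c). single m (lookup (hcomp (t - e x) c) m)) * y
            = (\<Sum>m\<in>keys (hcomp (t - e x) c). smul (lookup (hcomp (t - e x) c) m) (single m 1 * y))"
          unfolding sum_distrib_right
          by (intro sum.cong refl) (simp add: smul_def mult_single flip: mult.assoc)
        also have "\<dots> \<in> vs.span (?G t)"
        proof (intro vs.span_sum vs.span_scale vs.span_base)
          fix m assume "m \<in> keys (hcomp (t - e x) c)"
          then have "mdeg m = t - e x" by (auto simp: in_keys_iff lookup_hcomp split: if_splits)
          then have "mdeg m + e x = t" using True by simp
          then show "single m 1 * y \<in> ?G t" using x by blast
        qed
        finally show ?thesis
          using True x(2) unfolding poly_mapping_eq_sum_single[symmetric]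
          by (simp add: hcomp_mult[OF assms[OF x(1)]])
      qed (use x in \<open>simp add: hcomp_mult[OF assms[OF x(1)]] vs.span_zero\<close>)
      then show "hcomp t (c * y + z) \<in> vs.span (?G t)"
        using step by (simp add: hcomp_add vs.span_add)
    qed
  qed
  then show "ideal.span (g ` X) \<inter> homog t \<subseteq> vs.span (?G t)"
    by (metis (no_types, lifting) IntE hcomp_homog subsetI)
qed

subsection \<open>Hilbert functions and regular sequences\<close>

lemma hcomp_diff: "hcomp t (p - q) = hcomp t p - hcomp t q"
  by (rule poly_mapping_eqI) (simp add: lookup_hcomp lookup_minus)

lemma module_hom_mult: "module_hom smul smul (\<lambda>p. g * p :: ('i, 'k::field) mpoly)"
  by (simp add: module_hom_iff vs.module_axioms distrib_left smul_mult)

lemma dim_Int_le_homog: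
  fixes J :: "('i::finite, 'k::field) mpoly set"
  shows "vs.dim (homog t \<inter> J) \<le> vs.dim (homog t :: ('i, 'k) mpoly set)"
  by (rule vs.fin_dim_le[OF fin_dim_homog]) simp

lemma int_hilbert:
  fixes J :: "('i::finite, 'k::field) mpoly set"
  shows "int (hilbert J t) =
    int (vs.dim (homog t :: ('i, 'k) mpoly set)) - int (vs.dim (homog t \<inter> J))"
  by (simp add: hilbert_def dim_mod_def of_nat_diff dim_Int_le_homog)

lemma hilbert_cong: "homog t \<inter> J = homog t \<inter> K \<Longrightarrow> hilbert J t = hilbert K t"
  by (simp add: hilbert_def dim_mod_def)

lemma hilbert_eq_0_iff:
  fixes J :: "('i::finite, 'k::field) mpoly set"
  assumes "vs.subspace J"
  shows "hilbert J t = 0 \<longleftrightarrow> homog t \<subseteq> J"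
proof
  assume "hilbert J t = 0"
  then have "vs.dim (homog t :: ('i, 'k) mpoly set) \<le> vs.dim (homog t \<inter> J)"
    by (simp add: hilbert_def dim_mod_def)
  then have "homog t \<inter> J = homog t"
    by (intro vs.subspace_eqI fin_dim_homog vs.subspace_inter subspace_homog assms) simp_all
  then show "homog t \<subseteq> J" by blast
next
  assume "homog t \<subseteq> J"
  then have "homog t \<inter> J = homog t" by blast
  then show "hilbert J t = 0" by (simp add: hilbert_def dim_mod_def)
qed

lemma dim_mod_mult:
  fixes J :: "('i::finite, 'k::field) mpoly set"
  assumes J: "vs.subspace J"
  shows "int (dim_mod ((\<lambda>p. g * p) ` homog s) J) = int (vs.dim (homog s :: ('i, 'k) mpoly set)) - int (vs.dim {p\<in>homog s. g * p \<in> J})"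
proof -
  interpret m: module_hom smul smul "\<lambda>p. g * p" by (rule module_hom_mult)
  have "vs.fin_dim ((\<lambda>p. g * p) ` homog s)"
    using fin_dim_homog[of s] m.spans_image[of "homog s"] unfolding vs.fin_dim_def
    by (meson finite_imageI)
  then have "vs.dim ((\<lambda>p. g * p) ` homog s \<inter> J) \<le> vs.dim ((\<lambda>p. g * p) ` homog s)"
    by (rule vs.fin_dim_le) simp
  moreover have "vs.dim ((\<lambda>p. g * p) ` homog s) + vs.dim {p\<in>homog s. g * p \<in> J} =
      vs.dim (homog s :: ('i, 'k) mpoly set) + vs.dim ((\<lambda>p. g * p) ` homog s \<inter> J)"
    by (rule vs.dim_image_mod[OF module_hom_mult subspace_homog fin_dim_homog J])
  ultimately show ?thesis by (simp add: dim_mod_def)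
qed

text \<open>A nonzerodivisor modulo \<open>J\<close>, tested on forms only: this is what Hilbert
  functions can detect.\<close>

definition regular_on :: "('i::finite, 'k::field) mpoly \<Rightarrow> ('i, 'k) mpoly set \<Rightarrow> bool" where
  "regular_on g J \<longleftrightarrow> (\<forall>t. \<forall>p\<in>homog t. g * p \<in> J \<longrightarrow> p \<in> J)"

context
  fixes J :: "('i::finite, 'k::field) mpoly set"
  assumes J: "homogeneous_ideal J"
begin

text \<open>The forms of degree \<open>s\<close> that \<open>g\<close> multiplies into
  \<open>J\<close> include those in \<open>J\<close> itself, because \<open>J\<close> is an ideal;
  the rank drops exactly by the excess.\<close>

lemma dim_mod_mult_le: "dim_mod ((\<lambda>p. g * p) ` homog s) J \<le> hilbert J s"
  and dim_mod_mult_eq_iff: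
    "dim_mod ((\<lambda>p. g * p) ` homog s) J = hilbert J s \<longleftrightarrow> (\<forall>p\<in>homog s. g * p \<in> J \<longrightarrow> p \<in> J)"
proof -
  have Jv: "vs.subspace J" by (rule homogeneous_ideal_vs[OF J])
  interpret m: module_hom smul smul "\<lambda>p. g * p" by (rule module_hom_mult)
  have sub: "homog s \<inter> J \<subseteq> {p\<in>homog s. g * p \<in> J}"
    using ideal.subspace_scale[OF homogeneous_ideal_ideal[OF J]] by blast
  have fd: "vs.fin_dim {p\<in>homog s. g * p \<in> J}"
    by (rule vs.fin_dim_mono[OF fin_dim_homog[of s]]) auto
  have le: "vs.dim (homog s \<inter> J) \<le> vs.dim {p\<in>homog s. g * p \<in> J}"
    by (rule vs.fin_dim_le[OF fd sub])
  show "dim_mod ((\<lambda>p. g * p) ` homog s) J \<le> hilbert J s"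
    using dim_mod_mult[OF Jv, of g s] int_hilbert[of J s] le by simp
  have "dim_mod ((\<lambda>p. g * p) ` homog s) J = hilbert J s \<longleftrightarrow>
      vs.dim {p\<in>homog s. g * p \<in> J} \<le> vs.dim (homog s \<inter> J)"
    using dim_mod_mult[OF Jv, of g s] int_hilbert[of J s] le by linarith
  also have "\<dots> \<longleftrightarrow> homog s \<inter> J = {p\<in>homog s. g * p \<in> J}"
    using vs.subspace_eqI[OF fd vs.subspace_inter[OF subspace_homog Jv] sub] by force
  finally show "dim_mod ((\<lambda>p. g * p) ` homog s) J = hilbert J s \<longleftrightarrow> (\<forall>p\<in>homog s. g * p \<in> J \<longrightarrow> p \<in> J)"
    using sub by blast
qed

text \<open>This is the exact sequence \<open>(R/J)(-d) -> R/J -> R/(J + <g>) -> 0\<close> in degree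
  \<open>t\<close>. Taking the component of degree \<open>t\<close> in \<open>p - k * g\<close>
  shows that the new ideal has graded piece \<open>J_t + g R_{t-d}\<close>.\<close>

lemma hilbert_insert:
  assumes g: "g \<in> homog d"
  shows "int (hilbert (ideal.span (insert g J)) t) =
    int (hilbert J t) - (if d \<le> t then int (dim_mod ((\<lambda>p. g * p) ` homog (t - d)) J) else 0)"
proof -
  have Ji: "ideal.subspace J" by (rule homogeneous_ideal_ideal[OF J])
  have Jv: "vs.subspace J" by (rule homogeneous_ideal_vs[OF J])
  have mem: "p \<in> ideal.span (insert g J) \<longleftrightarrow> (\<exists>k. p - k * g \<in> J)" for p
    unfolding ideal.span_breakdown_eq using ideal.span_eq_iff Ji by metis
  have split: "p - hcomp (t - d) k * g \<in> J" if "p \<in> homog t" "p - k * g \<in> J" "d \<le> t" for p k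
  proof -
    have "hcomp t (p - k * g) = p - hcomp (t - d) k * g"
      using that g by (simp add: hcomp_diff hcomp_mult hcomp_homog)
    then show ?thesis using homogeneous_ideal_hcomp[OF J that(2), of t] by simp
  qed
  have split': "p \<in> J" if "p \<in> homog t" "p - k * g \<in> J" "\<not> d \<le> t" for p k
  proof -
    have "hcomp t (p - k * g) = p"
      using that g by (simp add: hcomp_diff hcomp_mult hcomp_homog)
    then show ?thesis using homogeneous_ideal_hcomp[OF J that(2), of t] by simp
  qed
  show ?thesis
  proof (cases "d \<le> t")
    case True
    let ?W = "(\<lambda>p. g * p) ` homog (t - d)"
    let ?A = "homog t \<inter> J"
    interpret m: module_hom smul smul "\<lambda>p. g * p" by (rule module_hom_mult)
    have W: "?W \<subseteq> homog t" using homog_mult[OF g, of _ "t - d"] True by auto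
    have fA: "vs.fin_dim ?A" by (rule vs.fin_dim_mono[OF fin_dim_homog[of t]]) auto
    have fW: "vs.fin_dim ?W" by (rule vs.fin_dim_mono[OF fin_dim_homog[of t] W])
    have "homog t \<inter> ideal.span (insert g J) = {x + y | x y. x \<in> ?A \<and> y \<in> ?W}" (is "?L = ?R")
    proof
      show "?R \<subseteq> ?L"
      proof safe
        fix x q :: "('i, 'k) mpoly" assume "x \<in> homog t" "x \<in> J" "q \<in> homog (t - d)"
        then show "x + g * q \<in> homog t" using W by (intro homog_add) auto
        show "x + g * q \<in> ideal.span (insert g J)"
          unfolding mem using \<open>x \<in> J\<close> by (intro exI[of _ q]) (simp add: mult.commute)
      qed
      show "?L \<subseteq> ?R"
      proof
        fix p assume p: "p \<in> ?L"
        then obtain k where "p - k * g \<in> J" using mem by blast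
        with p True have k: "p - hcomp (t - d) k * g \<in> J" using split by blast
        have "hcomp (t - d) k * g \<in> homog t"
          using W by (auto simp: mult.commute)
        then have "p - hcomp (t - d) k * g \<in> homog t"
          using p vs.subspace_diff[OF subspace_homog] by blast
        then have "p - hcomp (t - d) k * g \<in> ?A" using k by blast
        moreover have "g * hcomp (t - d) k \<in> ?W" by (intro imageI hcomp_in_homog)
        moreover have "p = (p - hcomp (t - d) k * g) + g * hcomp (t - d) k"
          by (simp add: mult.commute)
        ultimately show "p \<in> ?R" by (intro CollectI exI conjI)
      qed
    qed
    moreover have "?A \<inter> ?W = ?W \<inter> J" using W by blast
    moreover have "vs.dim {x + y | x y. x \<in> ?A \<and> y \<in> ?W} + vs.dim (?A \<inter> ?W) = vs.dim ?A + vs.dim ?W"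
      by (intro vs.dim_sums_Int fA fW vs.subspace_inter subspace_homog Jv m.subspace_image)
    moreover have "vs.dim (?W \<inter> J) \<le> vs.dim ?W"
      by (rule vs.fin_dim_le[OF fW]) simp
    ultimately show ?thesis
      using True by (simp add: int_hilbert dim_mod_def of_nat_diff)
  next
    case False
    have "homog t \<inter> ideal.span (insert g J) = homog t \<inter> J"
      using split' False ideal.span_superset[of "insert g J"] by (auto simp: mem)
    from hilbert_cong[OF this] show ?thesis using False by simp
  qed
qed

end

section \<open>Complete intersections recognized by their Hilbert functions\<close>

definition HF :: "('i::finite, 'k::field) mpoly set \<Rightarrow> nat \<Rightarrow> int" where
  "HF J t = int (hilbert J t)"

text \<open>On generating series this is multiplication by \<open>1 - z^d\<close>, the values in
  negative degrees being 0; hence these operators commute.\<close>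

definition hdiff :: "nat \<Rightarrow> (nat \<Rightarrow> int) \<Rightarrow> nat \<Rightarrow> int" where
  "hdiff d h t = h t - (if d \<le> t then h (t - d) else 0)"

lemma hdiff_commute: "hdiff a (hdiff b h) = hdiff b (hdiff a h)"
  by (rule ext) (auto simp: hdiff_def diff_diff_add add.commute)

lemma hdiff_le_HF_insert:
  assumes "homogeneous_ideal J" "g \<in> homog d"
  shows "hdiff d (HF J) t \<le> HF (ideal.span (insert g J)) t"
  using hilbert_insert[OF assms, of t] dim_mod_mult_le[OF assms(1), of g "t - d"]
  by (auto simp: HF_def hdiff_def)

lemma regular_on_iff_HF:
  assumes "homogeneous_ideal J" "g \<in> homog d"
  shows "regular_on g J \<longleftrightarrow> HF (ideal.span (insert g J)) = hdiff d (HF J)"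
proof -
  have "HF (ideal.span (insert g J)) t = hdiff d (HF J) t \<longleftrightarrow>
      (d \<le> t \<longrightarrow> (\<forall>p\<in>homog (t - d). g * p \<in> J \<longrightarrow> p \<in> J))" for t
    using hilbert_insert[OF assms, of t] dim_mod_mult_eq_iff[OF assms(1), of g "t - d"]
    by (auto simp: HF_def hdiff_def)
  then have "HF (ideal.span (insert g J)) = hdiff d (HF J) \<longleftrightarrow>
      (\<forall>t\<ge>d. \<forall>p\<in>homog (t - d). g * p \<in> J \<longrightarrow> p \<in> J)"
    by (simp add: fun_eq_iff)
  also have "\<dots> \<longleftrightarrow> regular_on g J"
    unfolding regular_on_def by (metis diff_add_inverse2 le_add2)
  finally show ?thesis ..
qed

lemma ideal_span_insert_span: "ideal.span (insert g (ideal.span G)) = ideal.span (insert g G)"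
  unfolding ideal.span_eq
  by (meson ideal.span_base ideal.span_mono ideal.span_superset insert_subset insertI1 order_trans
      subset_insertI)

text \<open>
  The Hilbert function of the quotient by a regular sequence of forms of degrees \<open>ds\<close>; the argument
  \<open>T\<close> only fixes the polynomial ring.
\<close>

definition CI :: "('i::finite, 'k::field) mpoly itself \<Rightarrow> nat list \<Rightarrow> nat \<Rightarrow> int" where
  "CI T ds = fold hdiff ds (HF ({0} :: ('i, 'k) mpoly set))"

lemma CI_Nil: "CI TYPE(('i::finite, 'k::field) mpoly) [] = HF ({0} :: ('i, 'k) mpoly set)"
  by (simp add: CI_def)

lemma CI_snoc: "CI TYPE(('i::finite, 'k::field) mpoly) (ds @ [d]) = hdiff d (CI TYPE(('i, 'k) mpoly) ds)"
  by (simp add: CI_def)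

abbreviation forms_of_degrees :: "('i::finite, 'k::field) mpoly list \<Rightarrow> nat list \<Rightarrow> bool" where
  "forms_of_degrees \<equiv> list_all2 (\<lambda>g d. g \<in> homog d)"

lemma homogeneous_ideal_span_list:
  "forms_of_degrees gs ds \<Longrightarrow> homogeneous_ideal (ideal.span (set gs))"
  by (rule homogeneous_ideal_span) (metis in_set_conv_nth list_all2_conv_all_nth)

text \<open>
  Killing a form of degree \<open>d\<close> lowers the Hilbert function by at most its shift by \<open>d\<close>. A sequence
  whose quotient is as small as that of a complete intersection therefore is one, at every stage:
  the defect of the previous stage at \<open>s\<close> is at most its defect at \<open>s - d\<close>.
\<close>

lemma HF_le_CI_butlast:
  fixes gs :: "('i::finite, 'k::field) mpoly list"
  assumes gs: "forms_of_degrees gs ds" and g: "g \<in> homog d" "d > 0"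
    and le: "\<And>s. s \<le> t \<Longrightarrow> HF (ideal.span (set (gs @ [g]))) s \<le> CI TYPE(('i, 'k) mpoly) (ds @ [d]) s"
    and "s \<le> t"
  shows "HF (ideal.span (set gs)) s \<le> CI TYPE(('i, 'k) mpoly) ds s"
  using \<open>s \<le> t\<close>
proof (induction s rule: less_induct)
  case (less s)
  have "hdiff d (HF (ideal.span (set gs))) s \<le> HF (ideal.span (set (gs @ [g]))) s"
    using hdiff_le_HF_insert[OF homogeneous_ideal_span_list[OF gs] g(1), of s]
    by (simp add: ideal_span_insert_span)
  also have "\<dots> \<le> hdiff d (CI TYPE(('i, 'k) mpoly) ds) s"
    using le less.prems by (simp add: CI_snoc)
  finally show ?case
    using less.IH[of "s - d"] less.prems g(2) by (auto simp: hdiff_def split: if_splits)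
qed

text \<open>The upper bound descends to the shorter sequence, where equality holds by induction;
  killing the last form then yields the lower bound. Each step looks only at degrees up to
  \<open>t\<close>, so a bound on an initial range gives equality on that range.\<close>

lemma HF_eq_CI:
  fixes gs :: "('i::finite, 'k::field) mpoly list"
  assumes "forms_of_degrees gs ds" "\<forall>d\<in>set ds. d > 0"
    and "\<And>s. s \<le> t \<Longrightarrow> HF (ideal.span (set gs)) s \<le> CI TYPE(('i, 'k) mpoly) ds s"
  shows "s \<le> t \<Longrightarrow> HF (ideal.span (set gs)) s = CI TYPE(('i, 'k) mpoly) ds s"
  using assms
proof (induction gs arbitrary: ds s rule: rev_induct)
  case Nil
  then show ?case by (simp add: CI_Nil)
next
  case (snoc g gs)
  obtain ds' d where ds: "ds = ds' @ [d]" and gs: "forms_of_degrees gs ds'" "g \<in> homog d"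
    using snoc.prems(2) by (auto simp: list_all2_append1 list_all2_Cons1)
  have pos: "d > 0" "\<forall>d\<in>set ds'. d > 0" using snoc.prems(3) ds by auto
  have le: "HF (ideal.span (set (gs @ [g]))) s \<le> CI TYPE(('i, 'k) mpoly) (ds' @ [d]) s" if "s \<le> t" for s
    using snoc.prems(4)[OF that] ds by simp
  have eq: "HF (ideal.span (set gs)) s = CI TYPE(('i, 'k) mpoly) ds' s" if "s \<le> t" for s
    using snoc.IH[OF that gs(1) pos(2)] HF_le_CI_butlast[OF gs pos(1) le] by blast
  have "CI TYPE(('i, 'k) mpoly) (ds' @ [d]) s = hdiff d (HF (ideal.span (set gs))) s"
    using snoc.prems(1) by (simp add: CI_snoc hdiff_def eq)
  also have "\<dots> \<le> HF (ideal.span (set (gs @ [g]))) s"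
    using hdiff_le_HF_insert[OF homogeneous_ideal_span_list[OF gs(1)] gs(2), of s]
    by (simp add: ideal_span_insert_span)
  finally show ?case using le[OF snoc.prems(1)] ds by simp
qed

text \<open>Equality of Hilbert functions before and after the last form is added is precisely the
  numerical criterion for that form to be regular.\<close>

lemma last_regular_on:
  fixes gs :: "('i::finite, 'k::field) mpoly list"
  assumes gs: "forms_of_degrees gs ds" "\<forall>d\<in>set ds. d > 0" and g: "g \<in> homog d" "d > 0"
    and le: "\<And>s. HF (ideal.span (set (gs @ [g]))) s \<le> CI TYPE(('i, 'k) mpoly) (ds @ [d]) s"
  shows "HF (ideal.span (set gs)) = CI TYPE(('i, 'k) mpoly) ds"
    and "regular_on g (ideal.span (set gs))"
proof -
  show eq: "HF (ideal.span (set gs)) = CI TYPE(('i, 'k) mpoly) ds"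
  proof
    fix s
    show "HF (ideal.span (set gs)) s = CI TYPE(('i, 'k) mpoly) ds s"
      by (rule HF_eq_CI[where t = s, OF gs HF_le_CI_butlast[OF gs(1) g le, where t = s]]) auto
  qed
  have "HF (ideal.span (set (gs @ [g]))) = CI TYPE(('i, 'k) mpoly) (ds @ [d])"
  proof
    fix s
    show "HF (ideal.span (set (gs @ [g]))) s = CI TYPE(('i, 'k) mpoly) (ds @ [d]) s"
      by (rule HF_eq_CI[where t = s]) (use gs g le in \<open>auto intro: list_all2_appendI\<close>)
  qed
  then show "regular_on g (ideal.span (set gs))"
    unfolding regular_on_iff_HF[OF homogeneous_ideal_span_list[OF gs(1)] g(1)]
    by (simp add: ideal_span_insert_span CI_snoc eq)
qed

lemma HF_CI_snoc:
  fixes gs :: "('i::finite, 'k::field) mpoly list"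
  assumes "forms_of_degrees gs ds" "HF (ideal.span (set gs)) = CI TYPE(('i, 'k) mpoly) ds"
    and "g \<in> homog d" "regular_on g (ideal.span (set gs))"
  shows "HF (ideal.span (set (gs @ [g]))) = CI TYPE(('i, 'k) mpoly) (ds @ [d])"
  using assms(4)[unfolded regular_on_iff_HF[OF homogeneous_ideal_span_list[OF assms(1)] assms(3)]]
  by (simp add: assms(2) ideal_span_insert_span CI_snoc)

lemma HF_regular_sequence:
  fixes gs :: "('i::finite, 'k::field) mpoly list"
  assumes "forms_of_degrees gs ds" "regular_sequence gs"
  shows "HF (ideal.span (set gs)) = CI TYPE(('i, 'k) mpoly) ds"
proof -
  have "\<forall>i<length gs. \<forall>p. p * gs ! i \<in> ideal.span (set (take i gs)) \<longrightarrow> p \<in> ideal.span (set (take i gs))"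
    using assms(2) by (simp add: regular_sequence_def)
  with assms(1) show ?thesis
  proof (induction gs arbitrary: ds rule: rev_induct)
    case Nil
    then show ?case by (simp add: CI_Nil)
  next
    case (snoc g gs)
    obtain ds' d where ds: "ds = ds' @ [d]" and gs: "forms_of_degrees gs ds'" "g \<in> homog d"
      using snoc.prems(1) by (auto simp: list_all2_append1 list_all2_Cons1)
    have "\<forall>i<length gs. \<forall>p. p * gs ! i \<in> ideal.span (set (take i gs)) \<longrightarrow> p \<in> ideal.span (set (take i gs))"
    proof (intro allI impI)
      fix i p assume "i < length gs" "p * gs ! i \<in> ideal.span (set (take i gs))"
      then show "p \<in> ideal.span (set (take i gs))"
        using snoc.prems(2)[rule_format, of i p] by (simp add: nth_append)
    qed
    then have "HF (ideal.span (set gs)) = CI TYPE(('i, 'k) mpoly) ds'"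
      using snoc.IH gs(1) by blast
    moreover have "regular_on g (ideal.span (set gs))"
      unfolding regular_on_def
    proof (intro allI ballI impI)
      fix p assume "g * p \<in> ideal.span (set gs)"
      then show "p \<in> ideal.span (set gs)"
        using snoc.prems(2)[rule_format, of "length gs" p] by (simp add: mult.commute[of p])
    qed
    ultimately show ?case
      unfolding ds by (intro HF_CI_snoc gs)
  qed
qed

subsection \<open>Hilbert functions in four variables\<close>

definition var :: "'i \<Rightarrow> ('i, 'k::comm_ring_1) mpoly" where
  "var i = single (single i 1) 1"

lemma homog_var: "var i \<in> homog 1"
  unfolding var_def by (rule homog_single) simp

text \<open>Subtraction of exponents is truncated, so \<open>k = m + (k - m)\<close> expresses that
  the monomial \<open>m\<close> divides \<open>k\<close>.\<close>

lemma lookup_single_mult: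
  fixes p :: "('i, 'k::comm_ring_1) mpoly"
  shows "lookup (single m c * p) k = (if k = m + (k - m) then c * lookup p (k - m) else 0)"
proof -
  have "single m c * p = single m c * (\<Sum>n\<in>keys p. single n (lookup p n))"
    using poly_mapping_eq_sum_single[of p] by simp
  also have "\<dots> = (\<Sum>n\<in>keys p. single (m + n) (c * lookup p n))"
    by (simp add: sum_distrib_left mult_single)
  finally have "lookup (single m c * p) k = (\<Sum>n\<in>keys p. if m + n = k then c * lookup p n else 0)"
    by (simp add: lookup_sum lookup_single when_def)
  also have "\<dots> = (\<Sum>n\<in>keys p. if n = k - m \<and> k = m + (k - m) then c * lookup p n else 0)"
    by (intro sum.cong) auto
  also have "\<dots> = (if k = m + (k - m) then c * lookup p (k - m) else 0)"
    by (simp add: in_keys_iff)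
  finally show ?thesis .
qed

lemma lookup_var_mult: "lookup (var i * p) (m + single i 1) = lookup p m"
  by (simp add: var_def lookup_single_mult add.commute)

lemma ideal_span_vars:
  "ideal.span (var ` S) = {p. \<forall>m\<in>keys p. \<exists>i\<in>S. lookup m i > 0}" (is "_ = ?J")
proof
  have "ideal.subspace ?J"
  proof (rule ideal.subspaceI)
    fix p q :: "('a, 'b) mpoly"
    assume "p \<in> ?J" "q \<in> ?J"
    then show "p + q \<in> ?J" using keys_add[of p q] by blast
  next
    fix c p :: "('a, 'b) mpoly"
    assume p: "p \<in> ?J"
    show "c * p \<in> ?J"
    proof (intro CollectI ballI)
      fix m assume "m \<in> keys (c * p)"
      then obtain a b where m: "m = a + b" and b: "b \<in> keys p" using keys_mult[of c p] by blast
      obtain i where "i \<in> S" "lookup b i > 0" using p b by blast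
      then show "\<exists>i\<in>S. lookup m i > 0" using m by (auto simp: lookup_add)
    qed
  qed simp
  moreover have "var ` S \<subseteq> ?J"
    by (auto simp: var_def lookup_single when_def)
  ultimately show "ideal.span (var ` S) \<subseteq> ?J"
    by (intro ideal.span_minimal)
  show "?J \<subseteq> ideal.span (var ` S)"
  proof
    fix p :: "('a, 'b) mpoly" assume p: "p \<in> ?J"
    have "(\<Sum>m\<in>keys p. single m (lookup p m)) \<in> ideal.span (var ` S)"
    proof (rule ideal.span_sum)
      fix m assume "m \<in> keys p"
      then obtain i where i: "i \<in> S" "lookup m i > 0" using p by blast
      have "m = (m - single i 1) + single i 1"
        using i(2) by (intro poly_mapping_eqI) (auto simp: lookup_add lookup_minus lookup_single when_def)
      then have "single m (lookup p m) = single (m - single i 1) (lookup p m) * var i"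
        by (simp add: var_def mult_single)
      also have "\<dots> \<in> ideal.span (var ` S)"
        using i(1) by (intro ideal.span_scale ideal.span_base imageI)
      finally show "single m (lookup p m) \<in> ideal.span (var ` S)" .
    qed
    then show "p \<in> ideal.span (var ` S)" unfolding poly_mapping_eq_sum_single[symmetric] .
  qed
qed

lemma regular_on_var:
  assumes "j \<notin> S"
  shows "regular_on (var j) (ideal.span (var ` S))"
  unfolding regular_on_def ideal_span_vars
proof (intro allI ballI impI CollectI)
  fix p :: "('a, 'b) mpoly" and m
  assume p: "var j * p \<in> {p. \<forall>m\<in>keys p. \<exists>i\<in>S. lookup m i > 0}" and m: "m \<in> keys p"
  have "m + single j 1 \<in> keys (var j * p)"
    using m lookup_var_mult[of j p m] by (simp add: in_keys_iff)
  then obtain i where "i \<in> S" "lookup (m + single j 1) i > 0" using p by blast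
  then show "\<exists>i\<in>S. lookup m i > 0"
    using assms by (intro bexI[of _ i]) (auto simp: lookup_add lookup_single when_def split: if_splits)
qed

lemma HF_span_vars:
  fixes xs :: "'i::finite list"
  assumes "distinct xs"
  shows "HF (ideal.span (var ` set xs) :: ('i, 'k::field) mpoly set) = CI TYPE(('i, 'k) mpoly) (replicate (length xs) 1)"
proof -
  have "HF (ideal.span (set (map var xs)) :: ('i, 'k) mpoly set) = CI TYPE(('i, 'k) mpoly) (replicate (length xs) 1)"
    using assms
  proof (induction xs rule: rev_induct)
    case Nil
    then show ?case by (simp add: CI_Nil)
  next
    case (snoc i xs)
    have "forms_of_degrees (map var xs :: ('i, 'k) mpoly list) (replicate (length xs) 1)"
      by (auto simp: list_all2_conv_all_nth intro!: homog_var[unfolded One_nat_def])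
    moreover have "regular_on (var i :: ('i, 'k) mpoly) (ideal.span (set (map var xs)))"
      using regular_on_var[of i "set xs"] snoc.prems by simp
    ultimately have "HF (ideal.span (set (map var xs @ [var i])) :: ('i, 'k) mpoly set) =
        CI TYPE(('i, 'k) mpoly) (replicate (length xs) 1 @ [1])"
      using snoc homog_var[of i] by (intro HF_CI_snoc) auto
    then show ?case by (simp add: replicate_append_same)
  qed
  then show ?thesis by simp
qed

lemma HF_irrelevant_ideal:
  "HF (ideal.span (range var) :: ('i::finite, 'k::field) mpoly set) t = (if t = 0 then 1 else 0)"
proof (cases "t = 0")
  case False
  have "homog t \<subseteq> (ideal.span (range var) :: ('i, 'k) mpoly set)"
  proof
    fix p :: "('i, 'k) mpoly" assume p: "p \<in> homog t"
    have "\<exists>i. lookup m i > 0" if "m \<in> keys p" for m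
    proof (rule ccontr)
      assume "\<nexists>i. lookup m i > 0"
      then have "mdeg m = 0" by (simp add: mdeg_def)
      moreover have "mdeg m = t" using p that by (simp add: homog_iff in_keys_iff)
      ultimately show False using False by simp
    qed
    then show "p \<in> ideal.span (range var)" by (simp add: ideal_span_vars)
  qed
  then show ?thesis
    using False hilbert_eq_0_iff[OF vs_subspace_ideal[OF ideal.subspace_span]] by (auto simp: HF_def)
next
  case True
  have mdeg0: "m = 0" if "mdeg m = 0" for m :: "'i \<Rightarrow>\<^sub>0 nat"
    using that by (intro poly_mapping_eqI) (simp add: mdeg_def)
  have one: "(1 :: ('i, 'k) mpoly) \<in> homog 0"
    by (simp add: homog_iff lookup_one when_def)
  have "homog 0 \<subseteq> vs.span {1 :: ('i, 'k) mpoly}"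
  proof
    fix p :: "('i, 'k) mpoly" assume "p \<in> homog 0"
    then have "p = smul (lookup p 0) 1"
      using mdeg0 by (intro poly_mapping_eqI) (auto simp: homog_iff lookup_one when_def)
    then show "p \<in> vs.span {1}" by (simp add: vs.span_singleton)
  qed
  moreover have "vs.span {1 :: ('i, 'k) mpoly} \<subseteq> homog 0"
    using one by (intro vs.span_minimal subspace_homog) simp
  ultimately have "homog 0 = vs.span {1 :: ('i, 'k) mpoly}" by (rule subset_antisym)
  then have "vs.dim (homog 0 :: ('i, 'k) mpoly set) = 1"
    using vs.dim_span_eq_card_independent[of "{1 :: ('i, 'k) mpoly}"] by simp
  moreover have "homog 0 \<inter> ideal.span (range var) = ({0} :: ('i, 'k) mpoly set)"
  proof -
    have "p = 0" if p: "p \<in> homog 0" "p \<in> ideal.span (range var)" for p :: "('i, 'k) mpoly"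
    proof (rule ccontr)
      assume "p \<noteq> 0"
      then obtain m where m: "m \<in> keys p" using keys_eq_empty by blast
      then have "mdeg m = 0" using p(1) by (simp add: homog_iff in_keys_iff)
      moreover obtain i where "lookup m i > 0" using m p(2) by (auto simp: ideal_span_vars)
      ultimately show False using mdeg0[of m] by simp
    qed
    then show ?thesis by (auto simp: ideal.span_zero)
  qed
  moreover have "vs.dim ({0} :: ('i, 'k) mpoly set) = 0"
    using vs.dim_le_card[of "{0}" "{}"] by simp
  ultimately show ?thesis using True by (simp add: HF_def int_hilbert)
qed

lemma hdiff_1_unique:
  assumes "\<And>t. hdiff 1 h t = hdiff 1 h' t"
  shows "h t = h' t"
proof (induction t)
  case 0
  show ?case using assms[of 0] by (simp add: hdiff_def)
next
  case (Suc t)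
  then show ?case using assms[of "Suc t"] by (simp add: hdiff_def)
qed

lemma UNIV_4_list: "(UNIV :: 4 set) = set [0, 1, 2, 3]" "distinct [0, 1, 2, 3 :: 4]"
proof -
  show d: "distinct [0, 1, 2, 3 :: 4]" by simp
  have "card (set [0, 1, 2, 3 :: 4]) = 4" using distinct_card[OF d] by simp
  then show "(UNIV :: 4 set) = set [0, 1, 2, 3]"
    using card_subset_eq[of "UNIV :: 4 set" "set [0, 1, 2, 3]"] by simp
qed

text \<open>The four variables form a regular sequence with quotient \<open>k\<close>. This
  determines the Hilbert function of the polynomial ring through its fourth difference, and no
  monomials have to be counted.\<close>

lemma CI_1111:
  "CI TYPE((4, 'k::field) mpoly) [1, 1, 1, 1] t = (if t = 0 then 1 else 0)"
  using HF_span_vars[OF UNIV_4_list(2), where 'k = 'k] HF_irrelevant_ideal[where 'i = 4 and 'k = 'k, of t]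
  unfolding UNIV_4_list(1)[symmetric] by (simp add: numeral_eq_Suc)

lemma fold_hdiff_snoc: "fold hdiff ds (hdiff d h) = hdiff d (fold hdiff ds h)"
  by (induction ds arbitrary: h) (simp_all add: hdiff_commute[of _ d])

text \<open>The degree 1 of a linear form occurs at either end of the list, depending on whether the
  form is killed before or after the forms of degree \<open>d\<close>.\<close>

lemma CI_rotate:
  "CI TYPE(('i::finite, 'k::field) mpoly) (d # ds) = CI TYPE(('i, 'k) mpoly) (ds @ [d])"
  by (simp add: CI_def fold_hdiff_snoc)

section \<open>Values of iterated differences of the binomial coefficient (t+3 choose 3)\<close>

context
  fixes h :: "nat \<Rightarrow> int"
  assumes h: "\<And>t. fold hdiff [1, 1, 1, 1] h t = (if t = 0 then 1 else 0)"
begin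

lemma hdiff_3: "hdiff 1 (hdiff 1 (hdiff 1 h)) t = 1"
proof (rule hdiff_1_unique[where h' = "\<lambda>_. 1"])
  show "hdiff 1 (hdiff 1 (hdiff 1 (hdiff 1 h))) t = hdiff 1 (\<lambda>_. 1) t" for t
    using h[of t] by (simp add: hdiff_def[of _ "\<lambda>_. 1"])
qed

lemma hdiff_2: "hdiff 1 (hdiff 1 h) t = int t + 1"
proof (rule hdiff_1_unique[where h' = "\<lambda>t. int t + 1"])
  show "hdiff 1 (hdiff 1 (hdiff 1 h)) t = hdiff 1 (\<lambda>t. int t + 1) t" for t
    using hdiff_3[of t] by (simp add: hdiff_def[of _ "\<lambda>t. int t + 1"] of_nat_diff)
qed

text \<open>The binomial coefficient (t+2 choose 2) with the denominator cleared, to stay within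
  integer polynomial identities; \<open>hdiff_0\<close> treats (t+3 choose 3) in the same
  way.\<close>

lemma hdiff_1: "2 * hdiff 1 h t = (int t + 1) * (int t + 2)"
proof (induction t)
  case 0
  show ?case using hdiff_2[of 0] by (simp add: hdiff_def)
next
  case (Suc t)
  then show ?case using hdiff_2[of "Suc t"]
    unfolding hdiff_def[of 1 "hdiff 1 h"] by (simp add: algebra_simps)
qed

lemma hdiff_0: "6 * h t = (int t + 1) * (int t + 2) * (int t + 3)"
proof (induction t)
  case 0
  show ?case using hdiff_1[of 0] by (simp add: hdiff_def)
next
  case (Suc t)
  have "2 * (h (Suc t) - h t) = (int (Suc t) + 1) * (int (Suc t) + 2)"
    using hdiff_1[of "Suc t"] by (simp add: hdiff_def)
  then have "6 * h (Suc t) = 6 * h t + 3 * ((int (Suc t) + 1) * (int (Suc t) + 2))"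
    by algebra
  also have "\<dots> = (int (Suc t) + 1) * (int (Suc t) + 2) * (int (Suc t) + 3)"
    unfolding Suc of_nat_Suc by algebra
  finally show ?case .
qed

text \<open>A second difference with step \<open>d\<close> annihilates the linear function
  \<open>t + 1\<close>. In degree \<open>2d - 1\<close> the term shifted by \<open>2d\<close> is
  absent, but its linear expression would be 0 there anyway.\<close>

lemma hdiff_dd_plane_eq_0:
  assumes "d \<ge> 1" "t \<ge> 2 * d - 1"
  shows "fold hdiff [1, 1, d, d] h t = 0"
  using assms hdiff_2 by (auto simp: hdiff_def[of d] of_nat_diff)

text \<open>A fourth difference with step \<open>d\<close> annihilates cubics; from degree
  \<open>4d\<close> on, all the shifted arguments are natural numbers, so the cubic formula applies
  to each of them.\<close>

lemma hdiff_dddd_eq_0: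
  assumes "t \<ge> 4 * d"
  shows "fold hdiff [d, d, d, d] h t = 0"
proof -
  obtain s where t: "t = 4 * d + s" using assms by (metis le_Suc_ex)
  have "6 * fold hdiff [d, d, d, d] h t =
      6 * h (4 * d + s) - 4 * (6 * h (3 * d + s)) + 6 * (6 * h (2 * d + s)) - 4 * (6 * h (d + s)) + 6 * h s"
    by (simp add: t hdiff_def algebra_simps)
  also have "\<dots> = 0"
    unfolding hdiff_0 of_nat_add of_nat_mult of_nat_numeral by algebra
  finally show ?thesis by simp
qed

text \<open>Modulo \<open>z^(2d)\<close> the factor \<open>2 (1 - z^d)^2 - (1 - z^d)^4\<close> is 1:
  the terms shifted by \<open>d\<close> cancel. What remains is the Hilbert function of the
  plane.\<close>

lemma hdiff_dd_section:
  assumes "t \<le> 2 * d - 2" "d \<ge> 1"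
  shows "2 * (2 * fold hdiff [1, d, d] h t - fold hdiff [1, d, d, d, d] h t) = (int t + 1) * (int t + 2)"
proof -
  have "\<not> d \<le> t - d" using assms by arith
  then have "2 * fold hdiff [1, d, d] h t - fold hdiff [1, d, d, d, d] h t = hdiff 1 h t"
    by (simp add: hdiff_def[of d])
  then show ?thesis using hdiff_1[of t] by simp
qed

text \<open>The stable value is the number of points of a plane complete intersection of type
  \<open>(d, d)\<close>, counted with multiplicity.\<close>

lemma hdiff_dd_degree:
  assumes "t \<ge> 2 * d - 1" "d \<ge> 1"
  shows "fold hdiff [1, d, d] h t = int d * int d"
proof -
  have int_pred: "int (2 * d - 1) = 2 * int d - 1" "int (d - 1) = int d - 1"
    using assms by auto
  have "2 * fold hdiff [1, d, d] h t = 2 * (int d * int d)"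
  \<comment> \<open>In degree \<open>2d - 1\<close> the term shifted by \<open>2d\<close> is absent;
    the polynomial \<open>(s + 1) (s + 2)\<close> that represents it is 0 at \<open>s = -1\<close>,
    so both cases yield the same value.\<close>
  proof (cases "t = 2 * d - 1")
    case True
    moreover have "\<not> d \<le> d - 1" "2 * d - 1 - d = d - 1" "d \<le> 2 * d - 1" using assms by arith+
    ultimately have "2 * fold hdiff [1, d, d] h t = 2 * hdiff 1 h (2 * d - 1) - 2 * (2 * hdiff 1 h (d - 1))"
      by (simp add: hdiff_def[of d])
    also have "\<dots> = 2 * (int d * int d)"
      unfolding hdiff_1 int_pred by algebra
    finally show ?thesis .
  next
    case False
    then have "t = 2 * d + (t - 2 * d)" using assms by arith
    then obtain s where t: "t = 2 * d + s" by blast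
    have "2 * fold hdiff [1, d, d] h t = 2 * hdiff 1 h (2 * d + s) - 2 * (2 * hdiff 1 h (d + s)) + 2 * hdiff 1 h s"
      by (simp add: t hdiff_def[of d] algebra_simps)
    also have "\<dots> = 2 * (int d * int d)"
      unfolding hdiff_1 of_nat_add of_nat_mult of_nat_numeral by algebra
    finally show ?thesis .
  qed
  then show ?thesis by simp
qed

lemma hdiff_dddd_nonneg:
  assumes "t \<le> 2 * d - 2" "d \<ge> 1"
  shows "fold hdiff [1, d, d, d, d] h t \<ge> 0"
proof (cases "d \<le> t")
  case True
  then obtain u where t: "t = u + d" by (metis add.commute le_Suc_ex)
  have "\<not> d \<le> u" using assms t by arith
  then have "2 * fold hdiff [1, d, d, d, d] h t = 2 * hdiff 1 h (u + d) - 4 * (2 * hdiff 1 h u)"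
    using t by (simp add: hdiff_def[of d])
  \<comment> \<open>The product \<open>4 (u + 1) (u + 2)\<close> is split as
    \<open>(2u + 2) (2u + 4)\<close> in order to compare factor by factor. The second comparison
    needs \<open>u \<le> d - 2\<close>, that is \<open>t \<le> 2d - 2\<close>.\<close>
  also have "\<dots> = (int (u + d) + 1) * (int (u + d) + 2) - (2 * int u + 2) * (2 * int u + 4)"
    unfolding hdiff_1 by algebra
  also have "\<dots> \<ge> 0"
    using mult_mono[of "2 * int u + 2" "int (u + d) + 1" "2 * int u + 4" "int (u + d) + 2"] assms t
    by auto
  finally show ?thesis by simp
next
  case False
  moreover have "0 \<le> (int t + 1) * (int t + 2)" by simp
  then have "0 \<le> hdiff 1 h t" unfolding hdiff_1[symmetric] by linarith
  ultimately show ?thesis by (simp add: hdiff_def[of d])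
qed

text \<open>The value is \<open>-d\<close>. Together with \<open>hdiff_dddd_nonneg\<close> this
  locates the change of sign, and thus the degree from which multiplication by a linear form is
  expected to be surjective.\<close>

lemma hdiff_dddd_nonpos:
  assumes "d \<ge> 1"
  shows "fold hdiff [1, d, d, d, d] h (2 * d - 1) \<le> 0"
proof -
  have int_pred: "int (2 * d - 1) = 2 * int d - 1" "int (d - 1) = int d - 1"
    using assms by auto
  have "\<not> d \<le> d - 1" "2 * d - 1 - d = d - 1" "d \<le> 2 * d - 1" using assms by arith+
  then have "2 * fold hdiff [1, d, d, d, d] h (2 * d - 1) = 2 * hdiff 1 h (2 * d - 1) - 4 * (2 * hdiff 1 h (d - 1))"
    using assms by (simp add: hdiff_def[of d])
  also have "\<dots> = - 2 * int d"
    unfolding hdiff_1 int_pred by algebra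
  finally show ?thesis by simp
qed

end

text \<open>Summing the h-vector gives triangular numbers up to degree \<open>2d - 2\<close>. The
  last of them is \<open>d (2d - 1)\<close>, and the final step \<open>d\<close> raises it to
  \<open>2d^2\<close>, the degree of two plane complete intersections together.\<close>

lemma hdiff_1_iff_triangular:
  fixes z :: "nat \<Rightarrow> int"
  assumes "d \<ge> 1"
  shows "(\<forall>t \<le> 2 * d - 2. hdiff 1 z t = int t + 1) \<and> hdiff 1 z (2 * d - 1) = int d \<and>
      (\<forall>t \<ge> 2 * d. hdiff 1 z t = 0) \<longleftrightarrow>
    (\<forall>t \<le> 2 * d - 2. 2 * z t = (int t + 1) * (int t + 2)) \<and> (\<forall>t \<ge> 2 * d - 1. z t = 2 * int d * int d)"
    (is "?L \<longleftrightarrow> ?R")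
proof -
  have idx: "2 * d - 1 - 1 = 2 * d - 2" "1 \<le> 2 * d - 1" using assms by arith+
  have last: "hdiff 1 z (2 * d - 1) = z (2 * d - 1) - z (2 * d - 2)"
    unfolding hdiff_def idx(1) using idx(2) by (simp only: if_True)
  have int_pred: "int (2 * d - 2) = 2 * int d - 2" using assms by auto
  have tri: "(2 * int d - 2 + 1) * (2 * int d - 2 + 2) + 2 * int d = 2 * (2 * int d * int d)"
    by algebra
  show ?thesis
  proof
  assume L: ?L
  have A: "2 * z t = (int t + 1) * (int t + 2)" if "t \<le> 2 * d - 2" for t
    using that
  proof (induction t)
    case 0
    then show ?case using L by (auto simp: hdiff_def)
  next
    case (Suc t)
    then have "hdiff 1 z (Suc t) = int (Suc t) + 1" using L by blast
    then show ?case using Suc by (simp add: hdiff_def algebra_simps)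
  qed
  have B: "z (2 * d - 1 + k) = 2 * int d * int d" for k
  proof (induction k)
    case 0
    have "2 * z (2 * d - 2) = (int (2 * d - 2) + 1) * (int (2 * d - 2) + 2)" by (rule A) simp
    then have "2 * z (2 * d - 1) = 2 * (2 * int d * int d)"
      using L last tri unfolding int_pred by linarith
    then show ?case by simp
  next
    case (Suc k)
    have "2 * d \<le> 2 * d - 1 + Suc k" by simp
    then have "hdiff 1 z (2 * d - 1 + Suc k) = 0" using L by blast
    then show ?case using Suc by (simp add: hdiff_def)
  qed
  have "z t = 2 * int d * int d" if "t \<ge> 2 * d - 1" for t
    using B[of "t - (2 * d - 1)"] that by simp
  then show ?R using A by blast
next
  assume R: ?R
  show ?L
  proof (intro conjI allI impI)
    fix t assume t: "t \<le> 2 * d - 2"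
    show "hdiff 1 z t = int t + 1"
    proof (cases t)
      case 0
      then show ?thesis using R t by (auto simp: hdiff_def)
    next
      case (Suc s)
      then have "2 * z t = (int t + 1) * (int t + 2)" "2 * z s = (int s + 1) * (int s + 2)" using R t by auto
      then show ?thesis using Suc by (simp add: hdiff_def algebra_simps)
    qed
  next
    have "2 * z (2 * d - 2) = (int (2 * d - 2) + 1) * (int (2 * d - 2) + 2)"
      "z (2 * d - 1) = 2 * int d * int d" using R by blast+
    then show "hdiff 1 z (2 * d - 1) = int d"
      using last tri unfolding int_pred by linarith
  next
    fix t assume "t \<ge> 2 * d"
    then have "z t = 2 * int d * int d" "z (t - 1) = 2 * int d * int d" "t \<ge> 1" using R assms by auto
    then show "hdiff 1 z t = 0" by (simp add: hdiff_def)
  qed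
qed
qed

subsection \<open>Polynomial functions and Zariski open sets\<close>

text \<open>Evaluation at a point over another ring, with \<open>c\<close> mapping the coefficients
  there. Besides \<open>eval_mpoly\<close> it covers restriction to a line in the parameter space,
  where the coordinates are univariate polynomials, and restriction of forms to a line or a point of
  projective space.\<close>

definition ev :: "('k::comm_ring_1 \<Rightarrow> 'r::comm_ring_1) \<Rightarrow> ('i::finite \<Rightarrow> 'r) \<Rightarrow> ('i, 'k) mpoly \<Rightarrow> 'r" where
  "ev c y p = (\<Sum>m\<in>keys p. c (lookup p m) * (\<Prod>i\<in>UNIV. y i ^ lookup m i))"

context
  fixes c :: "'k::comm_ring_1 \<Rightarrow> 'r::comm_ring_1"
  assumes c0: "c 0 = 0" and c_add: "\<And>a b. c (a + b) = c a + c b"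
    and c_mult: "\<And>a b. c (a * b) = c a * c b"
begin

lemma ev_superset:
  assumes "finite A" "keys p \<subseteq> A"
  shows "ev c y p = (\<Sum>m\<in>A. c (lookup p m) * (\<Prod>i\<in>UNIV. y i ^ lookup m i))"
  unfolding ev_def using assms by (intro sum.mono_neutral_left) (auto simp: in_keys_iff c0)

lemma ev_0: "ev c y 0 = 0"
  by (simp add: ev_def)

lemma ev_add: "ev c y (p + q) = ev c y p + ev c y q"
  using keys_add[of p q]
  by (simp add: ev_superset[of "keys p \<union> keys q"] lookup_add c_add distrib_right sum.distrib)

lemma ev_sum: "ev c y (sum f A) = (\<Sum>x\<in>A. ev c y (f x))"
  by (induction A rule: infinite_finite_induct) (simp_all add: ev_0 ev_add)

lemma ev_single: "ev c y (single m a) = c a * (\<Prod>i\<in>UNIV. y i ^ lookup m i)"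
  by (subst ev_superset[of "{m}"]) auto

lemma ev_mult: "ev c y (p * q) = ev c y p * ev c y q"
proof -
  have "ev c y (single m a * single n b) = ev c y (single m a) * ev c y (single n b)" for m n a b
    by (simp add: mult_single ev_single c_mult lookup_add power_add prod.distrib)
  then have "ev c y ((\<Sum>m\<in>keys p. single m (lookup p m)) * (\<Sum>n\<in>keys q. single n (lookup q n))) =
      ev c y (\<Sum>m\<in>keys p. single m (lookup p m)) * ev c y (\<Sum>n\<in>keys q. single n (lookup q n))"
    by (simp add: sum_product ev_sum)
  then show ?thesis unfolding poly_mapping_eq_sum_single[symmetric] .
qed

end

lemma eval_mpoly_ev: "eval_mpoly p a = ev (\<lambda>x. x) a p"
  by (simp add: eval_mpoly_def ev_def)

definition polyfun :: "(('i::finite \<Rightarrow> 'k::comm_ring_1) \<Rightarrow> 'k) \<Rightarrow> bool" where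
  "polyfun f \<longleftrightarrow> (\<exists>p. \<forall>a. f a = eval_mpoly p a)"

lemma polyfun_const: "polyfun (\<lambda>a. c)"
  unfolding polyfun_def eval_mpoly_ev by (intro exI[of _ "single 0 c"]) (simp add: ev_single)

lemma polyfun_coord: "polyfun (\<lambda>a. a i)"
proof -
  have "(\<Prod>j\<in>UNIV. a j ^ lookup (single i 1) j) = a i" for a :: "'a \<Rightarrow> 'b"
  proof -
    have "(\<Prod>j\<in>UNIV. a j ^ lookup (single i 1) j) = (\<Prod>j\<in>UNIV. if j = i then a j else 1)"
      by (intro prod.cong) (auto simp: lookup_single)
    then show ?thesis by simp
  qed
  then show ?thesis
    unfolding polyfun_def eval_mpoly_ev by (intro exI[of _ "single (single i 1) 1"]) (simp add: ev_single)
qed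

lemma polyfun_add: "polyfun f \<Longrightarrow> polyfun g \<Longrightarrow> polyfun (\<lambda>a. f a + g a)"
  unfolding polyfun_def eval_mpoly_ev using ev_add[of "\<lambda>x. x"] by metis

lemma polyfun_mult: "polyfun f \<Longrightarrow> polyfun g \<Longrightarrow> polyfun (\<lambda>a. f a * g a)"
  unfolding polyfun_def eval_mpoly_ev using ev_mult[of "\<lambda>x. x"] by metis

lemma polyfun_diff:
  assumes "polyfun f" "polyfun g"
  shows "polyfun (\<lambda>a. f a - g a)"
  using polyfun_add[OF assms(1) polyfun_mult[OF polyfun_const assms(2), of "-1"]] by simp

lemma polyfun_sum: "(\<And>x. x \<in> A \<Longrightarrow> polyfun (f x)) \<Longrightarrow> polyfun (\<lambda>a. \<Sum>x\<in>A. f x a)"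
  by (induction A rule: infinite_finite_induct) (simp_all add: polyfun_const polyfun_add)

lemma polyfun_if: "polyfun f \<Longrightarrow> polyfun g \<Longrightarrow> polyfun (\<lambda>a. if b then f a else g a)"
  by (cases b) simp_all

text \<open>Principal open sets form a basis, so openness can be shown with one polynomial per
  point. Conversely, all polynomials whose nonvanishing locus lies in \<open>U\<close> serve as
  equations of the complement.\<close>

lemma zariski_open_iff:
  "zariski_open U \<longleftrightarrow> (\<forall>a\<in>U. \<exists>P. polyfun P \<and> P a \<noteq> 0 \<and> (\<forall>b. P b \<noteq> 0 \<longrightarrow> b \<in> U))"
proof
  assume "zariski_open U"
  then obtain P where P: "- U = {a. \<forall>p\<in>P. eval_mpoly p a = 0}" unfolding zariski_open_def by blast
  show "\<forall>a\<in>U. \<exists>P. polyfun P \<and> P a \<noteq> 0 \<and> (\<forall>b. P b \<noteq> 0 \<longrightarrow> b \<in> U)"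
  proof
    fix a assume "a \<in> U"
    then obtain p where "p \<in> P" "eval_mpoly p a \<noteq> 0" using P by blast
    moreover have "polyfun (eval_mpoly p)" unfolding polyfun_def by blast
    ultimately show "\<exists>P. polyfun P \<and> P a \<noteq> 0 \<and> (\<forall>b. P b \<noteq> 0 \<longrightarrow> b \<in> U)"
      using P by (intro exI[of _ "eval_mpoly p"]) blast
  qed
next
  assume R: "\<forall>a\<in>U. \<exists>P. polyfun P \<and> P a \<noteq> 0 \<and> (\<forall>b. P b \<noteq> 0 \<longrightarrow> b \<in> U)"
  let ?P = "{p. \<forall>b. eval_mpoly p b \<noteq> 0 \<longrightarrow> b \<in> U}"
  have "- U = {a. \<forall>p\<in>?P. eval_mpoly p a = 0}"
  proof (intro subset_antisym subsetI)
    fix a assume a: "a \<in> {a. \<forall>p\<in>?P. eval_mpoly p a = 0}"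
    show "a \<in> - U"
    proof
      assume "a \<in> U"
      then obtain P where P: "polyfun P" "P a \<noteq> 0" "\<forall>b. P b \<noteq> 0 \<longrightarrow> b \<in> U" using R by blast
      then obtain p where "\<forall>a. P a = eval_mpoly p a" unfolding polyfun_def by blast
      then show False using P a by auto
    qed
  qed auto
  then show "zariski_open U" unfolding zariski_open_def by blast
qed

lemma zariski_open_UNIV: "zariski_open UNIV"
  unfolding zariski_open_iff using polyfun_const[of 1] by auto

lemma zariski_open_Int:
  fixes U V :: "('i::finite \<Rightarrow> 'k::idom) set"
  assumes "zariski_open U" "zariski_open V"
  shows "zariski_open (U \<inter> V)"
  unfolding zariski_open_iff
proof
  fix a assume "a \<in> U \<inter> V"
  then obtain P Q where "polyfun P" "P a \<noteq> 0" "\<forall>b. P b \<noteq> 0 \<longrightarrow> b \<in> U"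
    "polyfun Q" "Q a \<noteq> 0" "\<forall>b. Q b \<noteq> 0 \<longrightarrow> b \<in> V"
    using assms unfolding zariski_open_iff by (metis IntE)
  then show "\<exists>P. polyfun P \<and> P a \<noteq> 0 \<and> (\<forall>b. P b \<noteq> 0 \<longrightarrow> b \<in> U \<inter> V)"
    by (intro exI[of _ "\<lambda>a. P a * Q a"]) (simp add: polyfun_mult)
qed

lemma zariski_open_all:
  fixes C :: "'x \<Rightarrow> ('i::finite \<Rightarrow> 'k::idom) \<Rightarrow> bool"
  assumes "finite A" "\<And>x. x \<in> A \<Longrightarrow> zariski_open {a. C x a}"
  shows "zariski_open {a. \<forall>x\<in>A. C x a}"
  using assms
proof (induction A rule: finite_induct)
  case empty
  then show ?case by (simp add: zariski_open_UNIV)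
next
  case (insert x A)
  have "{a. \<forall>x\<in>insert x A. C x a} = {a. C x a} \<inter> {a. \<forall>x\<in>A. C x a}" by blast
  moreover have "zariski_open {a. C x a}" "zariski_open {a. \<forall>x\<in>A. C x a}"
    using insert by simp_all
  ultimately show ?case by (simp only: zariski_open_Int)
qed

lemma polyfun_line:
  assumes "polyfun P"
  shows "\<exists>q. \<forall>s. poly q s = P (\<lambda>i. a i + s * (b i - a i))"
proof -
  obtain p where p: "\<And>a. P a = eval_mpoly p a" using assms unfolding polyfun_def by blast
  show ?thesis
    by (intro exI[of _ "ev (\<lambda>c. [:c:]) (\<lambda>i. [:a i, b i - a i:]) p"])
      (simp add: p eval_mpoly_def ev_def poly_sum poly_prod)
qed

text \<open>On the line joining a point of \<open>U\<close> to a point of \<open>V\<close>, both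
  conditions are implied by the nonvanishing of nonzero univariate polynomials, and over an infinite
  field their product has a nonroot.\<close>

lemma zariski_open_irreducible:
  fixes U V :: "('i::finite \<Rightarrow> 'k::field_char_0) set"
  assumes "zariski_open U" "zariski_open V" "U \<noteq> {}" "V \<noteq> {}"
  shows "U \<inter> V \<noteq> {}"
proof -
  obtain a b where "a \<in> U" "b \<in> V" using assms by blast
  then obtain P Q where P: "polyfun P" "P a \<noteq> 0" "\<forall>b. P b \<noteq> 0 \<longrightarrow> b \<in> U"
    and Q: "polyfun Q" "Q b \<noteq> 0" "\<forall>b. Q b \<noteq> 0 \<longrightarrow> b \<in> V"
    using assms unfolding zariski_open_iff by metis
  obtain p q where p: "\<And>s. poly p s = P (\<lambda>i. a i + s * (b i - a i))"
    and q: "\<And>s. poly q s = Q (\<lambda>i. a i + s * (b i - a i))"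
    using polyfun_line[OF P(1)] polyfun_line[OF Q(1)] by metis
  have "p \<noteq> 0" using p[of 0] P(2) by auto
  moreover have "q \<noteq> 0" using q[of 1] Q(2) by auto
  ultimately have "p * q \<noteq> 0" by simp
  then obtain s where "poly (p * q) s \<noteq> 0" using poly_all_0_iff_0 by blast
  then show ?thesis using p[of s] q[of s] P(3) Q(3) by auto
qed

text \<open>Independence of a family rather than of a set: vectors depending on a parameter may
  coincide for some of its values, which has to count as dependence.\<close>

definition indep_on :: "'x set \<Rightarrow> ('x \<Rightarrow> ('i, 'k::field) mpoly) \<Rightarrow> bool" where
  "indep_on J v \<longleftrightarrow> (\<forall>c. (\<Sum>x\<in>J. smul (c x) (v x)) = 0 \<longrightarrow> (\<forall>x\<in>J. c x = 0))"

lemma indep_on_iff: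
  assumes "finite J"
  shows "indep_on J v \<longleftrightarrow> inj_on v J \<and> \<not> vs.dependent (v ` J)"
proof
  assume L: "indep_on J v"
  have inj: "inj_on v J"
  proof (rule inj_onI, rule ccontr)
    fix x y assume xy: "x \<in> J" "y \<in> J" "v x = v y" "x \<noteq> y"
    define c where "c z = (if z = x then 1 else if z = y then - 1 else 0 :: 'c)" for z
    have "(\<Sum>z\<in>J. smul (c z) (v z)) = (\<Sum>z\<in>{x, y}. smul (c z) (v z))"
      using assms xy by (intro sum.mono_neutral_right) (auto simp: c_def)
    also have "\<dots> = 0" using xy by (simp add: c_def)
    finally have "c x = 0" using L[unfolded indep_on_def, rule_format, of c x] xy(1) by simp
    then show False by (simp add: c_def)
  qed
  moreover have "\<not> vs.dependent (v ` J)"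
  proof (rule vs.independent_if_scalars_zero)
    fix f x assume "(\<Sum>x\<in>v ` J. smul (f x) x) = 0" "x \<in> v ` J"
    then show "f x = 0"
      using L[unfolded indep_on_def, rule_format, of "\<lambda>x. f (v x)"] by (auto simp: sum.reindex[OF inj])
  qed (use assms in simp)
  ultimately show "inj_on v J \<and> \<not> vs.dependent (v ` J)" ..
next
  assume R: "inj_on v J \<and> \<not> vs.dependent (v ` J)"
  then have inj: "inj_on v J" by simp
  show "indep_on J v"
    unfolding indep_on_def
  proof (intro allI impI ballI)
    fix c x assume c: "(\<Sum>x\<in>J. smul (c x) (v x)) = 0" and x: "x \<in> J"
    have "(\<Sum>y\<in>v ` J. smul (c (the_inv_into J v y)) y) = 0"
      unfolding sum.reindex[OF inj] using c by (simp add: the_inv_into_f_f[OF inj])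
    then have "c (the_inv_into J v (v x)) = 0"
      by (rule vs.independentD[OF conjunct2[OF R] finite_imageI[OF assms] subset_refl])
        (use x in blast)
    then show "c x = 0" by (simp add: the_inv_into_f_f[OF inj x])
  qed
qed

text \<open>One step of Gaussian elimination with a pivot that does not vanish at \<open>a\<close>.\<close>

lemma indep_on_open:
  fixes v :: "'x \<Rightarrow> ('j::finite \<Rightarrow> 'k::field) \<Rightarrow> ('i, 'k) mpoly"
  assumes "finite J" "\<And>x m. x \<in> J \<Longrightarrow> polyfun (\<lambda>a. lookup (v x a) m)"
    and "indep_on J (\<lambda>x. v x a)"
  shows "\<exists>P. polyfun P \<and> P a \<noteq> 0 \<and> (\<forall>b. P b \<noteq> 0 \<longrightarrow> indep_on J (\<lambda>x. v x b))"
  using assms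
proof (induction J arbitrary: v rule: finite_induct)
  case empty
  show ?case by (intro exI[of _ "\<lambda>_. 1"]) (simp add: polyfun_const indep_on_def)
next
  case (insert y J)
  have "v y a \<noteq> 0"
  proof
    assume "v y a = 0"
    then have "(\<Sum>x\<in>insert y J. smul ((\<lambda>x. if x = y then 1 else 0) x) (v x a)) = 0"
      by (intro sum.neutral) simp
    then have "(\<lambda>x. if x = y then 1 else 0 :: 'k) y = 0"
      by (rule insert.prems(2)[unfolded indep_on_def, rule_format]) simp
    then show False by simp
  qed
  then obtain m where m: "lookup (v y a) m \<noteq> 0"
    by (metis keys_eq_empty all_not_in_conv in_keys_iff)
  \<comment> \<open>Every \<open>w x b\<close> has coefficient 0 at the pivot monomial
    \<open>m\<close>. Cross-multiplying instead of dividing by the pivot keeps the coefficients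
    polynomial in \<open>b\<close>.\<close>
  define w where "w x b = smul (lookup (v y b) m) (v x b) - smul (lookup (v x b) m) (v y b)" for x b
  have sum_w: "(\<Sum>x\<in>J. smul (c x) (w x b)) =
      smul (lookup (v y b) m) (\<Sum>x\<in>J. smul (c x) (v x b)) - smul (\<Sum>x\<in>J. c x * lookup (v x b) m) (v y b)" for c b
    by (simp add: w_def vs.scale_right_diff_distrib sum_subtractf vs.scale_sum_right vs.scale_sum_left mult.commute)
  have "polyfun (\<lambda>b. lookup (w x b) n)" if "x \<in> J" for x n
    using that insert.prems(1) by (simp add: w_def lookup_minus polyfun_diff polyfun_mult)
  moreover have "indep_on J (\<lambda>x. w x a)"
    unfolding indep_on_def
  proof (intro allI impI ballI)
    fix c x assume c: "(\<Sum>x\<in>J. smul (c x) (w x a)) = 0" and x: "x \<in> J"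
    define c' where "c' z = (if z = y then - (\<Sum>x\<in>J. c x * lookup (v x a) m) else lookup (v y a) m * c z)" for z
    have "(\<Sum>x\<in>J. smul (c' x) (v x a)) = (\<Sum>x\<in>J. smul (lookup (v y a) m) (smul (c x) (v x a)))"
      using insert.hyps(2) by (intro sum.cong) (auto simp: c'_def)
    then have "(\<Sum>x\<in>insert y J. smul (c' x) (v x a)) = 0"
      using c insert.hyps by (simp add: sum_w c'_def vs.scale_sum_right)
    then have "c' x = 0" using insert.prems(2) x unfolding indep_on_def by blast
    then show "c x = 0" using x insert.hyps(2) m by (auto simp: c'_def split: if_splits)
  qed
  ultimately obtain P where P: "polyfun P" "P a \<noteq> 0" "\<forall>b. P b \<noteq> 0 \<longrightarrow> indep_on J (\<lambda>x. w x b)"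
    using insert.IH[of w] by blast
  show ?case
  proof (intro exI conjI allI impI)
    show "polyfun (\<lambda>b. P b * lookup (v y b) m)" using P insert.prems(1) by (simp add: polyfun_mult)
    show "P a * lookup (v y a) m \<noteq> 0" using P m by simp
    fix b assume b: "P b * lookup (v y b) m \<noteq> 0"
    show "indep_on (insert y J) (\<lambda>x. v x b)"
      unfolding indep_on_def
    proof (intro allI impI)
      fix c assume c: "(\<Sum>x\<in>insert y J. smul (c x) (v x b)) = 0"
      then have s: "(\<Sum>x\<in>J. smul (c x) (v x b)) = - smul (c y) (v y b)"
        using insert.hyps by (simp add: eq_neg_iff_add_eq_0 add.commute)
      have "lookup (\<Sum>x\<in>J. smul (c x) (v x b)) m = - (c y * lookup (v y b) m)"
        unfolding s by simp
      then have s': "(\<Sum>x\<in>J. c x * lookup (v x b) m) = - (c y * lookup (v y b) m)"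
        by (simp add: lookup_sum)
      have "(\<Sum>x\<in>J. smul (c x) (w x b)) = 0"
        unfolding sum_w s s' by (simp add: mult.commute)
      then have z: "\<forall>x\<in>J. c x = 0" using P(3) b unfolding indep_on_def by auto
      then have "c y * lookup (v y b) m = 0" using s' by simp
      then show "\<forall>x\<in>insert y J. c x = 0" using z b by simp
    qed
  qed
qed

text \<open>Semicontinuity of the rank: a subfamily that is a basis of the span at \<open>a\<close>
  remains independent on a principal open neighbourhood.\<close>

lemma zariski_open_dim_span_ge:
  fixes v :: "'x \<Rightarrow> ('j::finite \<Rightarrow> 'k::field) \<Rightarrow> ('i, 'k) mpoly"
  assumes X: "finite X" and v: "\<And>x m. x \<in> X \<Longrightarrow> polyfun (\<lambda>a. lookup (v x a) m)"
  shows "zariski_open {a. r \<le> vs.dim (vs.span ((\<lambda>x. v x a) ` X))}"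
  unfolding zariski_open_iff
proof
  fix a assume "a \<in> {a. r \<le> vs.dim (vs.span ((\<lambda>x. v x a) ` X))}"
  then have r: "r \<le> vs.dim ((\<lambda>x. v x a) ` X)" by simp
  obtain B where B: "B \<subseteq> (\<lambda>x. v x a) ` X" "\<not> vs.dependent B" "card B = vs.dim ((\<lambda>x. v x a) ` X)"
    by (rule vs.basis_exists)
  obtain J where J: "J \<subseteq> X" "inj_on (\<lambda>x. v x a) J" "B = (\<lambda>x. v x a) ` J"
    using B(1) unfolding subset_image_inj by blast
  have finJ: "finite J" using J(1) X finite_subset by blast
  have cJ: "r \<le> card J" using r B(3) J card_image by metis
  have "indep_on J (\<lambda>x. v x a)" using indep_on_iff[OF finJ] J B(2) by blast
  then obtain P where P: "polyfun P" "P a \<noteq> 0" "\<forall>b. P b \<noteq> 0 \<longrightarrow> indep_on J (\<lambda>x. v x b)"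
    using indep_on_open[OF finJ, of v a] v J(1) by blast
  have "r \<le> vs.dim (vs.span ((\<lambda>x. v x b) ` X))" if "P b \<noteq> 0" for b
  proof -
    have i: "inj_on (\<lambda>x. v x b) J" "\<not> vs.dependent ((\<lambda>x. v x b) ` J)"
      using P(3) that indep_on_iff[OF finJ, of "\<lambda>x. v x b"] by blast+
    have "vs.fin_dim (vs.span ((\<lambda>x. v x b) ` X))"
      unfolding vs.fin_dim_def using X by blast
    moreover have "(\<lambda>x. v x b) ` J \<subseteq> vs.span ((\<lambda>x. v x b) ` X)"
      using J(1) vs.span_superset by fast
    ultimately have "card ((\<lambda>x. v x b) ` J) \<le> vs.dim (vs.span ((\<lambda>x. v x b) ` X))"
      using i(2) by (intro vs.card_le_dim(2))
    then show ?thesis using cJ card_image[OF i(1)] by simp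
  qed
  then show "\<exists>P. polyfun P \<and> P a \<noteq> 0 \<and> (\<forall>b. P b \<noteq> 0 \<longrightarrow> b \<in> {a. r \<le> vs.dim (vs.span ((\<lambda>x. v x a) ` X))})"
    using P by blast
qed

text \<open>An upper bound on the quotient is a lower bound on the rank of the multiples of the
  generators. As the degrees \<open>e\<close> do not vary with the parameter, the same finite family
  of multiples works everywhere.\<close>

lemma zariski_open_HF_le:
  fixes g :: "'x \<Rightarrow> ('j::finite \<Rightarrow> 'k::field) \<Rightarrow> ('i::finite, 'k) mpoly"
  assumes X: "finite X" and g: "\<And>x m. x \<in> X \<Longrightarrow> polyfun (\<lambda>a. lookup (g x a) m)"
    and e: "\<And>x a. x \<in> X \<Longrightarrow> g x a \<in> homog (e x)"
  shows "zariski_open {a. HF (ideal.span ((\<lambda>x. g x a) ` X)) t \<le> C}"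
proof -
  let ?Y = "{(m :: 'i \<Rightarrow>\<^sub>0 nat, x). x \<in> X \<and> mdeg m + e x = t}"
  let ?v = "\<lambda>(m, x) a. single m 1 * g x a"
  have "?Y \<subseteq> (\<Union>s\<le>t. {m. mdeg m = s}) \<times> X" by auto
  then have fin: "finite ?Y" by (rule finite_subset) (use X in \<open>simp add: finite_mdeg\<close>)
  have "polyfun (\<lambda>a. lookup (?v y a) n)" if "y \<in> ?Y" for y n
    using that g by (auto simp: lookup_single_mult intro!: polyfun_if polyfun_mult polyfun_const)
  note op = zariski_open_dim_span_ge[OF fin this]
  \<comment> \<open>The conversion \<open>nat\<close> turns the rank condition into a trivial one if
    \<open>C\<close> is at least the dimension of the whole graded piece.\<close>
  have "HF (ideal.span ((\<lambda>x. g x a) ` X)) t \<le> C \<longleftrightarrow>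
      nat (int (vs.dim (homog t :: ('i, 'k) mpoly set)) - C) \<le> vs.dim (vs.span ((\<lambda>y. ?v y a) ` ?Y))" for a
  proof -
    have "homog t \<inter> ideal.span ((\<lambda>x. g x a) ` X) = vs.span {single m 1 * g x a | m x. x \<in> X \<and> mdeg m + e x = t}"
      using ideal_span_piece[of X "\<lambda>x. g x a" e t] e by blast
    also have "{single m 1 * g x a | m x. x \<in> X \<and> mdeg m + e x = t} = (\<lambda>y. ?v y a) ` ?Y"
      unfolding image_def Bex_def split_paired_Ex by auto
    finally show ?thesis unfolding HF_def int_hilbert by auto
  qed
  then show ?thesis using op[where r = "nat (int (vs.dim (homog t :: ('i, 'k) mpoly set)) - C)"] by simp
qed

subsection \<open>Forms without common zero on a line\<close>

text \<open>Restriction to the line \<open>x\<^sub>0 = x\<^sub>1 = 0\<close> in the chart \<open>x\<^sub>3 = 1\<close>.\<close>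

definition dehom :: "(4, 'k::field) mpoly \<Rightarrow> 'k poly" where
  "dehom = ev (\<lambda>c. [:c:]) (\<lambda>i. if i = 2 then [:0, 1:] else if i = 3 then 1 else 0)"

lemma dehom_0: "dehom 0 = 0"
  unfolding dehom_def by (rule ev_0) simp_all

lemma dehom_add: "dehom (p + q) = dehom p + dehom q"
  unfolding dehom_def by (rule ev_add) simp_all

lemma dehom_mult: "dehom (p * q) = dehom p * dehom q"
  unfolding dehom_def by (rule ev_mult) simp_all

lemma dehom_sum: "dehom (sum f A) = (\<Sum>x\<in>A. dehom (f x))"
  unfolding dehom_def by (rule ev_sum) simp_all

lemma prod_4: "(\<Prod>i\<in>(UNIV :: 4 set). g i) = g 0 * g 1 * g 2 * (g 3 :: 'a::comm_monoid_mult)"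
  unfolding UNIV_4_list(1) by (simp add: mult.assoc)

lemma sum_4: "(\<Sum>i\<in>(UNIV :: 4 set). g i) = g 0 + g 1 + g 2 + (g 3 :: 'a::comm_monoid_add)"
  unfolding UNIV_4_list(1) by (simp add: add.assoc)

lemma all_4: "(\<forall>i :: 4. P i) \<longleftrightarrow> P 0 \<and> P 1 \<and> P 2 \<and> P 3"
  using UNIV_4_list(1) by (metis UNIV_I empty_iff empty_set insert_iff list.simps(15))

lemma dehom_single:
  "dehom (single m c) = (if lookup m 0 = 0 \<and> lookup m 1 = 0 then monom c (lookup m 2) else 0)"
proof -
  have "dehom (single m c) = [:c:] * (\<Prod>i\<in>UNIV. (if i = 2 then [:0, 1:] else if i = 3 then 1 else 0) ^ lookup m i)"
    unfolding dehom_def by (rule ev_single) simp_all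
  then show ?thesis
    by (auto simp: prod_4 monom_altdef)
qed

lemma dehom_eq_sum:
  "dehom p = (\<Sum>m\<in>keys p. if lookup m 0 = 0 \<and> lookup m 1 = 0 then monom (lookup p m) (lookup m 2) else 0)"
proof -
  have "dehom (\<Sum>m\<in>keys p. single m (lookup p m)) =
      (\<Sum>m\<in>keys p. if lookup m 0 = 0 \<and> lookup m 1 = 0 then monom (lookup p m) (lookup m 2) else 0)"
    unfolding dehom_sum dehom_single ..
  then show ?thesis unfolding poly_mapping_eq_sum_single[symmetric] .
qed

lemma mdeg_4: "mdeg m = lookup m 0 + lookup m 1 + lookup m 2 + lookup m (3 :: 4)"
  by (simp add: mdeg_def sum_4)

lemma degree_dehom_le:
  assumes "p \<in> homog t"
  shows "degree (dehom p) \<le> t"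
  unfolding dehom_eq_sum
proof (rule degree_sum_le)
  fix m assume "m \<in> keys p"
  then have "mdeg m = t" using assms by (simp add: homog_iff in_keys_iff)
  then have "lookup m 2 \<le> t" by (simp add: mdeg_4)
  then show "degree (if lookup m 0 = 0 \<and> lookup m 1 = 0 then monom (lookup p m) (lookup m 2) else 0) \<le> t"
    using degree_monom_le[of "lookup p m" "lookup m 2"] by auto
qed simp

abbreviation line_exp :: "nat \<Rightarrow> nat \<Rightarrow> (4 \<Rightarrow>\<^sub>0 nat)" where
  "line_exp n s \<equiv> single 2 n + single 3 s"

lemma coeff_dehom:
  assumes "p \<in> homog t" "n \<le> t"
  shows "coeff (dehom p) n = lookup p (line_exp n (t - n))"
proof -
  have iff: "lookup m 0 = 0 \<and> lookup m 1 = 0 \<and> lookup m 2 = n \<longleftrightarrow> m = line_exp n (t - n)"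
    if "m \<in> keys p" for m
  proof -
    have "mdeg m = t" using that assms(1) by (simp add: homog_iff in_keys_iff)
    then have "lookup m 0 + lookup m 1 + lookup m 2 + lookup m 3 = t" by (simp add: mdeg_4)
    moreover have "m = line_exp n (t - n) \<longleftrightarrow>
        lookup m 0 = 0 \<and> lookup m 1 = 0 \<and> lookup m 2 = n \<and> lookup m 3 = t - n"
      unfolding poly_mapping_eq_iff fun_eq_iff all_4 by (simp add: lookup_add lookup_single)
    ultimately show ?thesis by auto
  qed
  have "coeff (dehom p) n =
      (\<Sum>m\<in>keys p. if lookup m 0 = 0 \<and> lookup m 1 = 0 \<and> lookup m 2 = n then lookup p m else 0)"
    unfolding dehom_eq_sum coeff_sum by (intro sum.cong) auto
  also have "\<dots> = (\<Sum>m\<in>keys p. if m = line_exp n (t - n) then lookup p m else 0)"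
    using iff by (intro sum.cong refl) simp
  also have "\<dots> = lookup p (line_exp n (t - n))"
    by (simp add: in_keys_iff)
  finally show ?thesis .
qed

text \<open>In a form of known degree the exponent of \<open>x_2\<close> determines that of
  \<open>x_3\<close> once \<open>x_0\<close> and \<open>x_1\<close> are absent, so no two such
  monomials are merged by setting \<open>x_3 = 1\<close>.\<close>

lemma dehom_eq_0_imp:
  assumes "p \<in> homog t" "dehom p = 0"
  shows "p \<in> ideal.span {var 0, var 1}"
proof -
  have "\<exists>i\<in>{0, 1}. lookup m i > 0" if m: "m \<in> keys p" for m
  proof (rule ccontr)
    assume "\<not> (\<exists>i\<in>{0, 1}. lookup m i > 0)"
    then have z: "lookup m 0 = 0" "lookup m 1 = 0" by auto
    have "mdeg m = t" using m assms(1) by (simp add: homog_iff in_keys_iff)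
    then have t: "lookup m 2 + lookup m 3 = t" using z by (simp add: mdeg_4)
    then have "m = line_exp (lookup m 2) (t - lookup m 2)"
      unfolding poly_mapping_eq_iff fun_eq_iff all_4 using z by (auto simp: lookup_add lookup_single)
    then have "lookup p m = coeff (dehom p) (lookup m 2)"
      using coeff_dehom[OF assms(1), of "lookup m 2"] t by simp
    then show False using m assms(2) by (simp add: in_keys_iff)
  qed
  then have "p \<in> ideal.span (var ` {0, 1})" unfolding ideal_span_vars by blast
  then show ?thesis by simp
qed

lemma dehom_dvd:
  fixes g :: "(4, 'k::field) mpoly"
  assumes "p \<in> ideal.span {var 0, var 1, g}"
  shows "dehom g dvd dehom p"
  using assms
proof (induction rule: ideal.span_induct_alt)
  case base
  show ?case by (simp add: dehom_0)
next
  case (step c x y)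
  have "dehom (var 0 :: (4, 'k) mpoly) = 0" "dehom (var 1 :: (4, 'k) mpoly) = 0"
    by (simp_all add: var_def dehom_single lookup_single)
  then have "dehom g dvd dehom x" using step(1) by auto
  then show ?case using step(2) by (simp add: dehom_add dehom_mult)
qed

lemma exists_homogenization:
  assumes "degree q \<le> s"
  shows "\<exists>p\<in>homog s. dehom p = q"
proof
  let ?p = "\<Sum>n\<le>s. single (line_exp n (s - n)) (coeff q n)"
  show "?p \<in> homog s"
    by (intro vs.subspace_sum[OF subspace_homog] homog_single) (simp add: mdeg_4 lookup_add lookup_single)
  have "dehom ?p = (\<Sum>n\<le>s. monom (coeff q n) n)"
    by (simp add: dehom_sum dehom_single lookup_add lookup_single)
  then show "dehom ?p = q" using poly_as_sum_of_monoms'[OF assms] by simp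
qed

text \<open>Linear factors of \<open>F\<close> are removed one at a time: a root of \<open>F\<close>
  is not a root of \<open>G\<close>, hence is one of \<open>p\<close>.\<close>

lemma dvd_of_dvd_mult_no_common_root:
  fixes F G p :: "'k::alg_closed_field poly"
  assumes "F \<noteq> 0" "F dvd G * p" "\<And>z. poly F z = 0 \<Longrightarrow> poly G z \<noteq> 0"
  shows "F dvd p"
  using assms
proof (induction "degree F" arbitrary: F p)
  case 0
  then show ?case by (metis dvd_trans is_unit_iff_degree one_dvd)
next
  case (Suc n)
  then obtain z where z: "poly F z = 0" using alg_closed_imp_poly_has_root[of F] by auto
  then obtain F' where F': "F = [:- z, 1:] * F'" by (metis poly_eq_0_iff_dvd dvdE)
  have F'0: "F' \<noteq> 0" using F' Suc.prems(1) by auto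
  obtain k where k: "G * p = F * k" using Suc.prems(2) by (rule dvdE)
  have "poly (G * p) z = 0" unfolding k using z by simp
  then have "poly p z = 0" using Suc.prems(3)[OF z] by simp
  then obtain p' where p': "p = [:- z, 1:] * p'" by (metis poly_eq_0_iff_dvd dvdE)
  have "[:- z, 1:] * F' dvd [:- z, 1:] * (G * p')"
    using Suc.prems(2) unfolding F' p' by (simp only: mult.left_commute)
  then have "F' dvd G * p'" by (subst (asm) dvd_mult_cancel_left) auto
  moreover have "n = degree F'" using Suc.hyps(2) F'0 unfolding F' by (subst (asm) degree_mult_eq) auto
  moreover have "poly G x \<noteq> 0" if "poly F' x = 0" for x
    using Suc.prems(3)[of x] that unfolding F' by simp
  ultimately have "F' dvd p'" using Suc.hyps(1) F'0 by blast
  then show ?case unfolding F' p' by (rule mult_dvd_mono[OF dvd_refl])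
qed

text \<open>
  The hypotheses say that \<open>g1\<close> and \<open>g2\<close> have no common zero on the line \<open>x\<^sub>0 = x\<^sub>1 = 0\<close>: the condition
  on the degree is \<open>g1 \<noteq> 0\<close> at the point with \<open>x\<^sub>3 = 0\<close>, the condition on the roots covers the others.
\<close>

lemma HF_line_section:
  fixes g1 g2 :: "(4, 'k::alg_closed_field) mpoly"
  assumes g: "g1 \<in> homog d" "g2 \<in> homog d" and deg: "dehom g1 \<noteq> 0" "degree (dehom g1) = d"
    and root: "\<And>z. poly (dehom g1) z = 0 \<Longrightarrow> poly (dehom g2) z \<noteq> 0"
  shows "HF (ideal.span {var 0, var 1, g1, g2}) = CI TYPE((4, 'k) mpoly) [1, 1, d, d]"
proof -
  have "(2::nat) = Suc (Suc 0)" by simp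
  then have H2: "HF (ideal.span (set [var 0, var 1 :: (4, 'k) mpoly])) = CI TYPE((4, 'k) mpoly) [1, 1]"
    using HF_span_vars[of "[0, 1 :: 4]", where 'k = 'k] by simp
  have fv: "forms_of_degrees [var 0, var 1 :: (4, 'k) mpoly] [1, 1]"
    by (simp add: homog_var[unfolded One_nat_def])
  have "regular_on g1 (ideal.span (set [var 0, var 1]))"
    unfolding regular_on_def
  proof (intro allI ballI impI)
    fix t p assume p: "p \<in> homog t" "g1 * p \<in> ideal.span (set [var 0, var 1])"
    then have "g1 * p \<in> ideal.span {var 0, var 1, 0}"
      using ideal.span_mono[of "{var 0, var 1}" "{var 0, var 1, 0}"] by auto
    then have "dehom g1 * dehom p = 0" using dehom_dvd[of "g1 * p" 0] by (simp add: dehom_mult dehom_0)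
    then show "p \<in> ideal.span (set [var 0, var 1])" using deg dehom_eq_0_imp[OF p(1)] by simp
  qed
  then have H3: "HF (ideal.span (set ([var 0, var 1] @ [g1]))) = CI TYPE((4, 'k) mpoly) ([1, 1] @ [d])"
    by (intro HF_CI_snoc fv H2 g)
  have "regular_on g2 (ideal.span (set ([var 0, var 1] @ [g1])))"
    unfolding regular_on_def
  proof (intro allI ballI impI)
    fix t p assume p: "p \<in> homog t" "g2 * p \<in> ideal.span (set ([var 0, var 1] @ [g1]))"
    have "dehom g1 dvd dehom g2 * dehom p" using dehom_dvd[of "g2 * p" g1] p(2) by (simp add: dehom_mult)
    then have "dehom g1 dvd dehom p" using dvd_of_dvd_mult_no_common_root deg(1) root by blast
    then obtain q where q: "dehom p = dehom g1 * q" by (rule dvdE)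
    \<comment> \<open>The quotient has to be lifted to a form of degree \<open>t - d\<close>. This
      needs the degree of \<open>dehom g1\<close> to be exactly \<open>d\<close>, which is where the
      absence of a zero at \<open>x_3 = 0\<close> enters. For \<open>q = 0\<close> the degree count
      says nothing, and \<open>t < d\<close> is possible.\<close>
    have "\<exists>q'. dehom q' = q \<and> g1 * q' \<in> homog t"
    proof (cases "q = 0")
      case True
      then show ?thesis by (intro exI[of _ 0]) (simp add: dehom_0)
    next
      case False
      then have "d + degree q \<le> t"
        using degree_dehom_le[OF p(1)] deg unfolding q by (simp add: degree_mult_eq)
      then have "degree q \<le> t - d" by simp
      then obtain q' where "q' \<in> homog (t - d)" "dehom q' = q"
        using exists_homogenization by blast
      then show ?thesis
        using homog_mult[OF g(1), of q' "t - d"] \<open>d + degree q \<le> t\<close> by (intro exI[of _ q']) simp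
    qed
    then obtain q' where q': "dehom q' = q" "g1 * q' \<in> homog t" by blast
    have "dehom (p - g1 * q') + dehom (g1 * q') = dehom p" by (simp flip: dehom_add)
    then have "dehom (p - g1 * q') = 0" using q q'(1) by (simp add: dehom_mult)
    then have "p - g1 * q' \<in> ideal.span {var 0, var 1}"
      using dehom_eq_0_imp vs.subspace_diff[OF subspace_homog p(1) q'(2)] by blast
    then have "p - g1 * q' \<in> ideal.span (set ([var 0, var 1] @ [g1]))"
      using ideal.span_mono[of "{var 0, var 1}" "set ([var 0, var 1] @ [g1])"] by auto
    moreover have "q' * g1 \<in> ideal.span (set ([var 0, var 1] @ [g1]))"
      by (intro ideal.span_scale ideal.span_base) simp
    ultimately have "(p - g1 * q') + q' * g1 \<in> ideal.span (set ([var 0, var 1] @ [g1]))"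
      by (rule ideal.span_add)
    then show "p \<in> ideal.span (set ([var 0, var 1] @ [g1]))" by (simp add: mult.commute)
  qed
  moreover have "forms_of_degrees ([var 0, var 1] @ [g1]) ([1, 1] @ [d])"
    using fv g(1) by (simp add: list_all2_appendI)
  ultimately have "HF (ideal.span (set (([var 0, var 1] @ [g1]) @ [g2]))) =
      CI TYPE((4, 'k) mpoly) (([1, 1] @ [d]) @ [d])"
    by (intro HF_CI_snoc H3 g)
  then show ?thesis by simp
qed

text \<open>Forms generating an ideal that contains a power of the irrelevant ideal have no common
  zero. Some \<open>f i\<close> is nonzero at the point of the line with \<open>x_3 = 0\<close>, so
  it has finitely many zeros on the line, and a combination of all four forms avoids these
  zeros.\<close>

lemma exists_line_section:
  fixes f :: "4 \<Rightarrow> (4, 'k::{alg_closed_field, field_char_0}) mpoly"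
  assumes f: "\<And>i. f i \<in> homog d" and d: "d \<ge> 1" and N: "homog N \<subseteq> ideal.span (range f)"
  shows "\<exists>i c. HF (ideal.span {var 0, var 1, f i, \<Sum>j\<in>UNIV. smul (c j) (f j)}) =
    CI TYPE((4, 'k) mpoly) [1, 1, d, d]"
proof -
  have "\<exists>i. lookup (f i) (single 2 d) \<noteq> 0"
  proof (rule ccontr)
    assume a: "\<not> (\<exists>i. lookup (f i) (single 2 d) \<noteq> 0)"
    \<comment> \<open>Evaluation at the point with \<open>x_2 = 1\<close> and all other coordinates
      0. If every \<open>f i\<close> vanished there, so would every element of the ideal, including
      \<open>x_2^N\<close>.\<close>
    define \<epsilon> :: "(4, 'k) mpoly \<Rightarrow> 'k" where "\<epsilon> = ev (\<lambda>c. c) (\<lambda>i. if i = 2 then 1 else 0)"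
    have \<epsilon>_single: "\<epsilon> (single m c) = (if m = single 2 (mdeg m) then c else 0)" for m c
    proof -
      have "\<epsilon> (single m c) = c * (\<Prod>i\<in>UNIV. (if i = 2 then 1 else 0) ^ lookup m i)"
        unfolding \<epsilon>_def by (rule ev_single) simp_all
      moreover have "m = single 2 (mdeg m) \<longleftrightarrow> lookup m 0 = 0 \<and> lookup m 1 = 0 \<and> lookup m 3 = 0"
        unfolding poly_mapping_eq_iff fun_eq_iff all_4 by (auto simp: mdeg_4 lookup_single)
      ultimately show ?thesis by (auto simp: prod_4)
    qed
    have \<epsilon>_f: "\<epsilon> (f i) = 0" for i
    proof -
      have "\<epsilon> (\<Sum>m\<in>keys (f i). single m (lookup (f i) m)) = (\<Sum>m\<in>keys (f i). \<epsilon> (single m (lookup (f i) m)))"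
        unfolding \<epsilon>_def by (rule ev_sum) simp_all
      also have "\<dots> = 0"
      proof (rule sum.neutral, rule ballI)
        fix m assume "m \<in> keys (f i)"
        then have "mdeg m = d" using f[of i] by (simp add: homog_iff in_keys_iff)
        then show "\<epsilon> (single m (lookup (f i) m)) = 0" using a by (auto simp: \<epsilon>_single)
      qed
      finally show ?thesis unfolding poly_mapping_eq_sum_single[symmetric] .
    qed
    have "\<epsilon> p = 0" if "p \<in> ideal.span (range f)" for p
      using that
    proof (induction rule: ideal.span_induct_alt)
      case base
      show ?case unfolding \<epsilon>_def by (rule ev_0) simp_all
    next
      case (step c x y)
      have "\<epsilon> (c * x + y) = \<epsilon> (c * x) + \<epsilon> y" unfolding \<epsilon>_def by (rule ev_add) simp_all
      also have "\<epsilon> (c * x) = \<epsilon> c * \<epsilon> x" unfolding \<epsilon>_def by (rule ev_mult) simp_all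
      finally show ?case using step \<epsilon>_f by auto
    qed
    moreover have "single (single 2 N) 1 \<in> ideal.span (range f)"
      using N homog_single[of "single 2 N" N] by auto
    ultimately have "\<epsilon> (single (single 2 N) 1) = 0" by blast
    then show False by (simp add: \<epsilon>_single)
  qed
  then obtain i where i: "lookup (f i) (single 2 d) \<noteq> 0" by blast
  have "coeff (dehom (f i)) d \<noteq> 0" using coeff_dehom[OF f[of i], of d] i by simp
  then have F: "dehom (f i) \<noteq> 0" "degree (dehom (f i)) = d"
    using degree_dehom_le[OF f[of i]] le_degree by (auto intro: le_antisym)
  \<comment> \<open>As a polynomial in \<open>s\<close>, \<open>W z\<close> is the value at
    \<open>z\<close> of \<open>f_0 + s f_1 + s^2 f_2 + s^3 f_3\<close>. It is nonzero for every
    \<open>z\<close>, so one \<open>s\<close> avoids the roots of \<open>W z\<close> for all the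
    finitely many zeros \<open>z\<close> of \<open>f i\<close>.\<close>
  define W where "W z = [:poly (dehom (f 0)) z, poly (dehom (f 1)) z, poly (dehom (f 2)) z, poly (dehom (f 3)) z:]" for z
  have W: "W z \<noteq> 0" for z
  proof
    assume "W z = 0"
    then have fz: "poly (dehom (f j)) z = 0" for j
      using all_4[of "\<lambda>j. poly (dehom (f j)) z = 0"] by (simp add: W_def)
    have "poly (dehom p) z = 0" if "p \<in> ideal.span (range f)" for p
      using that
      by (induction rule: ideal.span_induct_alt) (auto simp: dehom_0 dehom_add dehom_mult fz)
    moreover have "single (single 3 N) 1 \<in> ideal.span (range f)"
      using N homog_single[of "single 3 N" N] by auto
    ultimately have "poly (dehom (single (single 3 N) 1)) z = 0" by blast
    then show False by (simp add: dehom_single lookup_single)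
  qed
  have fin: "finite {z. poly (dehom (f i)) z = 0}" using F(1) by (rule poly_roots_finite)
  then have "(\<Prod>z\<in>{z. poly (dehom (f i)) z = 0}. W z) \<noteq> 0" using W by simp
  then obtain s where "poly (\<Prod>z\<in>{z. poly (dehom (f i)) z = 0}. W z) s \<noteq> 0"
    using poly_all_0_iff_0 by blast
  then have s: "poly (W z) s \<noteq> 0" if "poly (dehom (f i)) z = 0" for z
    using fin that by (auto simp: poly_prod)
  define c where "c j = (if j = 0 then 1 else if j = 1 then s else if j = 2 then s ^ 2 else s ^ 3)" for j :: 4
  let ?g = "\<Sum>j\<in>UNIV. smul (c j) (f j)"
  have dehom_smul: "dehom (smul a p) = smult a (dehom p)" for a p
    by (simp add: smul_def dehom_mult dehom_single monom_0)
  have c: "c 0 = 1" "c 1 = s" "c 2 = s ^ 2" "c 3 = s ^ 3"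
    by (simp_all add: c_def)
  have "poly (dehom ?g) z = poly (W z) s" for z
    unfolding sum_4 c dehom_add dehom_smul W_def poly_add poly_smult poly_pCons poly_0 by algebra
  then have "poly (dehom ?g) z \<noteq> 0" if "poly (dehom (f i)) z = 0" for z
    using s that by simp
  moreover have "?g \<in> homog d"
    by (intro vs.subspace_sum[OF subspace_homog] vs.subspace_scale[OF subspace_homog] f)
  ultimately show ?thesis
    using HF_line_section[OF f _ F] by blast
qed

subsection \<open>The hyperplane section\<close>

lemma homog_Suc_subset:
  fixes K :: "('i::finite, 'k::field) mpoly set"
  assumes "ideal.subspace K" "homog s \<subseteq> K"
  shows "homog (Suc s) \<subseteq> K"
proof
  fix p :: "('i, 'k) mpoly" assume p: "p \<in> homog (Suc s)"
  have "(\<Sum>m\<in>keys p. single m (lookup p m)) \<in> K"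
  proof (rule ideal.subspace_sum[OF assms(1)])
    fix m assume "m \<in> keys p"
    then have m: "mdeg m = Suc s" using p by (simp add: homog_iff in_keys_iff)
    have "\<exists>i. lookup m i > 0"
    proof (rule ccontr)
      assume "\<nexists>i. lookup m i > 0"
      then have "mdeg m = 0" by (simp add: mdeg_def)
      then show False using m by simp
    qed
    then obtain i where i: "lookup m i > 0" by blast
    have e: "m = single i 1 + (m - single i 1)"
      using i by (intro poly_mapping_eqI) (auto simp: lookup_add lookup_minus lookup_single when_def)
    then have "Suc s = 1 + mdeg (m - single i 1)" using m mdeg_add mdeg_single by metis
    then have "single (m - single i 1) (lookup p m) \<in> K" using assms(2) homog_single by auto
    then have "single (single i 1) 1 * single (m - single i 1) (lookup p m) \<in> K"
      by (rule ideal.subspace_scale[OF assms(1)])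
    then show "single m (lookup p m) \<in> K" unfolding mult_single e[symmetric] by simp
  qed
  then show "p \<in> K" unfolding poly_mapping_eq_sum_single[symmetric] .
qed

text \<open>An ideal containing all forms of one degree contains all forms of every higher degree.
  This is what extends checks up to degree \<open>2d - 1\<close> to all degrees.\<close>

lemma HF_eq_0_mono:
  assumes "ideal.subspace K" "HF K s \<le> 0" "s \<le> t"
  shows "HF K t = 0"
proof -
  have "homog s \<subseteq> K"
    using assms(2) hilbert_eq_0_iff[OF vs_subspace_ideal[OF assms(1)], of s] by (simp add: HF_def)
  with assms(3) have "homog t \<subseteq> K"
    by (induction t rule: dec_induct) (use homog_Suc_subset[OF assms(1)] in blast)+
  then show ?thesis
    using hilbert_eq_0_iff[OF vs_subspace_ideal[OF assms(1)], of t] by (simp add: HF_def)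
qed

lemma HF_nonneg: "HF J t \<ge> 0"
  by (simp add: HF_def)

text \<open>The quotient by \<open>L\<close> in degree \<open>t + 1\<close> is the cokernel of the
  multiplication, so a rank equal to the minimum means a cokernel of dimension \<open>max 0\<close>
  of the difference.\<close>

lemma maximal_rank_iff:
  assumes "homogeneous_ideal J" "L \<in> homog 1"
  shows "maximal_rank J L t \<longleftrightarrow>
    HF (ideal.span (insert L J)) (t + 1) = max 0 (hdiff 1 (HF J) (t + 1))"
  using hilbert_insert[OF assms, of "t + 1"]
  by (auto simp: maximal_rank_def HF_def hdiff_def)

lemma max_hdiff_le_HF_insert:
  assumes "homogeneous_ideal J" "L \<in> homog 1"
  shows "max 0 (hdiff 1 (HF J) t) \<le> HF (ideal.span (insert L J)) t"
  using hdiff_le_HF_insert[OF assms] HF_nonneg by simp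

lemma HF_insert_0:
  assumes "homogeneous_ideal J" "L \<in> homog 1"
  shows "HF (ideal.span (insert L J)) 0 = HF J 0"
  using hilbert_insert[OF assms, of 0] by (simp add: HF_def)

lemma homog_power: "p \<in> homog 1 \<Longrightarrow> p ^ n \<in> homog n"
proof (induction n)
  case 0
  show ?case by (simp add: homog_iff lookup_one when_def)
next
  case (Suc n)
  then show ?case using homog_mult[of p 1 "p ^ n" n] by simp
qed

lemma regular_on_power:
  assumes "regular_on M J" "M \<in> homog 1" "p \<in> homog t" "M ^ n * p \<in> J"
  shows "p \<in> J"
  using assms(4)
proof (induction n)
  case (Suc n)
  have "M ^ n * p \<in> homog (n + t)" using homog_power[OF assms(2)] assms(3) by (rule homog_mult)
  moreover have "M * (M ^ n * p) \<in> J" using Suc.prems unfolding power_Suc mult.assoc .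
  ultimately have "M ^ n * p \<in> J" using assms(1) unfolding regular_on_def by blast
  then show ?case by (rule Suc.IH)
qed simp

text \<open>
  An element of both \<open>\<langle>L, V1\<rangle>\<close> and \<open>\<langle>L, V2\<rangle>\<close> is multiplied into \<open>\<langle>V1\<rangle> \<inter> \<langle>V2\<rangle> + \<langle>L\<rangle>\<close> by
  \<open>\<langle>V1\<rangle> + \<langle>V2\<rangle>\<close>, hence by a power of the irrelevant ideal.
\<close>

lemma homog_Int_section_ideal:
  fixes V1 V2 :: "('i::finite, 'k::field) mpoly set"
  assumes M: "M \<in> homog 1" "regular_on M (ideal.span (insert L V1))" "regular_on M (ideal.span (insert L V2))"
    and N: "homog N \<subseteq> ideal.span (V1 \<union> V2)"
  shows "homog t \<inter> section_ideal V1 V2 L =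
    homog t \<inter> (ideal.span (insert L V1) \<inter> ideal.span (insert L V2))"
proof -
  let ?K = "ideal.span (curve_ideal V1 V2 \<union> {L})"
  have K: "?K \<subseteq> ideal.span (insert L V)" if "V = V1 \<or> V = V2" for V
  proof (rule ideal.span_minimal)
    have "ideal.span V \<subseteq> ideal.span (insert L V)" by (rule ideal.span_mono) blast
    then show "curve_ideal V1 V2 \<union> {L} \<subseteq> ideal.span (insert L V)"
      using that by (auto simp: curve_ideal_def intro: ideal.span_base)
  qed (rule ideal.subspace_span)
  have "p \<in> ideal.span (insert L V)"
    if V: "V = V1 \<or> V = V2" and p: "p \<in> homog t" "p \<in> section_ideal V1 V2 L" for p V
  proof -
    obtain n where n: "\<forall>q\<in>homog n. q * p \<in> ?K"
      using p(2) unfolding section_ideal_def saturation_def by blast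
    \<comment> \<open>Among the multipliers of degree \<open>n\<close> this one can be cancelled
      modulo both ideals; that makes them saturated.\<close>
    have "M ^ n \<in> homog n" by (rule homog_power[OF M(1)])
    then have "M ^ n * p \<in> ideal.span (insert L V)" using n K[OF V] by blast
    then show ?thesis using regular_on_power M p(1) V by blast
  qed
  moreover have "p \<in> section_ideal V1 V2 L"
    if p: "p \<in> ideal.span (insert L V1)" "p \<in> ideal.span (insert L V2)" for p
  proof -
    obtain k1 k2 where k: "p - k1 * L \<in> ideal.span V1" "p - k2 * L \<in> ideal.span V2"
      using p unfolding ideal.span_breakdown_eq by blast
    have "q * p \<in> ?K" if "q \<in> homog N" for q
    proof -
      obtain a b where q: "q = a + b" "a \<in> ideal.span V1" "b \<in> ideal.span V2"
        using N \<open>q \<in> homog N\<close> unfolding ideal.span_Un by blast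
      \<comment> \<open>The pairing is crosswise: \<open>a\<close> lies in the first ideal and
        \<open>p - k2 * L\<close> in the second, so the product lies in both. The same holds for
        \<open>b\<close> with \<open>k1\<close>.\<close>
      have "a * (p - k2 * L) \<in> curve_ideal V1 V2"
        using ideal.span_scale[OF q(2), of "p - k2 * L"] ideal.span_scale[OF k(2), of a]
        by (simp add: curve_ideal_def mult.commute)
      moreover have "b * (p - k1 * L) \<in> curve_ideal V1 V2"
        using ideal.span_scale[OF q(3), of "p - k1 * L"] ideal.span_scale[OF k(1), of b]
        by (simp add: curve_ideal_def mult.commute)
      moreover have "c * L \<in> ?K" for c
        by (intro ideal.span_scale ideal.span_base) simp
      ultimately have "a * (p - k2 * L) + (a * k2) * L \<in> ?K" "b * (p - k1 * L) + (b * k1) * L \<in> ?K"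
        by (auto intro!: ideal.span_add intro: ideal.span_base)
      then have "a * p \<in> ?K" "b * p \<in> ?K"
        unfolding right_diff_distrib mult.assoc diff_add_cancel .
      then show ?thesis unfolding q(1) distrib_right by (rule ideal.span_add)
    qed
    then show ?thesis unfolding section_ideal_def saturation_def by blast
  qed
  ultimately show ?thesis by blast
qed

text \<open>The exact sequence \<open>0 -> R/(J_1 \<inter> J_2) -> R/J_1 \<oplus> R/J_2 -> R/(J_1 +
  J_2) -> 0\<close>, where the sum of the two ideals is generated by \<open>L\<close> and both
  planes.\<close>

lemma HF_section_ideal:
  fixes V1 V2 :: "('i::finite, 'k::field) mpoly set"
  assumes M: "M \<in> homog 1" "regular_on M (ideal.span (insert L V1))" "regular_on M (ideal.span (insert L V2))"
    and N: "homog N \<subseteq> ideal.span (V1 \<union> V2)"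
    and V: "V1 \<subseteq> homog d" "V2 \<subseteq> homog d" "L \<in> homog 1"
  shows "HF (section_ideal V1 V2 L) t =
    HF (ideal.span (insert L V1)) t + HF (ideal.span (insert L V2)) t - HF (ideal.span (insert L (V1 \<union> V2))) t"
proof -
  let ?J1 = "ideal.span (insert L V1)" and ?J2 = "ideal.span (insert L V2)"
  let ?A = "homog t \<inter> ?J1" and ?B = "homog t \<inter> ?J2"
  have h: "homogeneous_ideal ?J1" "homogeneous_ideal ?J2"
    using V by (auto intro!: homogeneous_ideal_span)
  have sub: "vs.subspace ?A" "vs.subspace ?B"
    by (intro vs.subspace_inter subspace_homog homogeneous_ideal_vs h)+
  have fd: "vs.fin_dim ?A" "vs.fin_dim ?B"
    by (rule vs.fin_dim_mono[OF fin_dim_homog[of t]], simp)+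
  have "homog t \<inter> ideal.span (insert L (V1 \<union> V2)) = {x + y | x y. x \<in> ?A \<and> y \<in> ?B}"
  proof -
    have U: "ideal.span (insert L (V1 \<union> V2)) = {x + y | x y. x \<in> ?J1 \<and> y \<in> ?J2}"
      using ideal.span_Un[of "insert L V1" "insert L V2"] by simp
    show ?thesis
    proof (intro subset_antisym subsetI)
      fix p assume p: "p \<in> homog t \<inter> ideal.span (insert L (V1 \<union> V2))"
      then obtain x y where xy: "p = x + y" "x \<in> ?J1" "y \<in> ?J2" unfolding U by blast
      have "p = hcomp t x + hcomp t y"
        using p hcomp_homog[of p t t] unfolding xy(1) by (simp add: hcomp_add)
      moreover have "hcomp t x \<in> ?A" "hcomp t y \<in> ?B"
        using homogeneous_ideal_hcomp h xy by auto
      ultimately show "p \<in> {x + y | x y. x \<in> ?A \<and> y \<in> ?B}" by blast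
    next
      fix p assume "p \<in> {x + y | x y. x \<in> ?A \<and> y \<in> ?B}"
      then show "p \<in> homog t \<inter> ideal.span (insert L (V1 \<union> V2))"
        unfolding U using homog_add by blast
    qed
  qed
  moreover have "?A \<inter> ?B = homog t \<inter> section_ideal V1 V2 L"
    using homog_Int_section_ideal[OF M N] by blast
  ultimately show ?thesis
    using vs.dim_sums_Int[OF sub(1) fd(1) sub(2) fd(2)] by (simp add: HF_def int_hilbert)
qed

lemma ideal_span_insert_vs_span: "ideal.span (S \<union> vs.span G) = ideal.span (S \<union> G)"
proof (rule subset_antisym)
  have "vs.span G \<subseteq> ideal.span (S \<union> G)"
    by (intro vs.span_minimal vs_subspace_ideal ideal.subspace_span)
      (use ideal.span_superset in blast)
  then show "ideal.span (S \<union> vs.span G) \<subseteq> ideal.span (S \<union> G)"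
    by (intro ideal.span_minimal ideal.subspace_span)
      (use ideal.span_superset in blast)
  show "ideal.span (S \<union> G) \<subseteq> ideal.span (S \<union> vs.span G)"
    by (intro ideal.span_mono) (use vs.span_superset in blast)
qed

lemma homog_linear_form: "linear_form l \<in> homog 1"
proof -
  have "lookup (linear_form l) m = 0" if "mdeg m \<noteq> 1" for m
    using that by (auto simp: linear_form_def lookup_sum smul_def mult_single lookup_single when_def intro!: sum.neutral)
  then show ?thesis unfolding homog_iff by blast
qed

lemma linear_form_delta: "linear_form (\<lambda>i. if i = j then 1 else 0) = var j"
proof -
  have "linear_form (\<lambda>i. if i = j then 1 else 0) = (\<Sum>i\<in>UNIV. if i = j then var i else 0)"
    unfolding linear_form_def by (intro sum.cong) (auto simp: smul_def var_def mult_single)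
  then show ?thesis by simp
qed

lemma polyfun_linear_form:
  fixes l :: "'i::finite \<Rightarrow> ('j::finite \<Rightarrow> 'k::field) \<Rightarrow> 'k"
  assumes "\<And>i. polyfun (l i)"
  shows "polyfun (\<lambda>a. lookup (linear_form (\<lambda>i. l i a)) m)"
  unfolding linear_form_def lookup_sum lookup_smul
  by (intro polyfun_sum polyfun_mult polyfun_const assms)

lemma polyfun_frame_form: "polyfun (\<lambda>a. lookup (frame_form b a j) m)"
  unfolding frame_form_def lookup_sum lookup_smul
  by (intro polyfun_sum polyfun_mult polyfun_const polyfun_coord)

lemma fold_hdiff_1111:
  fixes h :: "nat \<Rightarrow> int"
  defines "h \<equiv> HF ({0} :: (4, 'k::field) mpoly set)"
  shows "fold hdiff [1, 1, 1, 1] h t = (if t = 0 then 1 else 0)"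
  using CI_1111[where 'k = 'k, of t] by (simp add: CI_def h_def)

subsection \<open>Maximal rank and the h-vector\<close>

text \<open>Only upper bounds, and only in finitely many degrees, so that this is an open condition
  on \<open>L\<close>. The reverse inequality is automatic for a homogeneous ideal and a form
  \<open>L\<close> of degree 1, by \<open>max_hdiff_le_HF_insert\<close>.\<close>

definition lefschetz_bound :: "('i::finite, 'k::field) mpoly set \<Rightarrow> nat \<Rightarrow> ('i, 'k) mpoly \<Rightarrow> bool" where
  "lefschetz_bound J n L \<longleftrightarrow> (\<forall>t\<le>n. HF (ideal.span (insert L J)) t \<le> max 0 (hdiff 1 (HF J) t))"

lemma all_maximal_rank_iff:
  fixes J :: "(4, 'k::field) mpoly set"
  assumes J: "homogeneous_ideal J" "HF J = CI TYPE((4, 'k) mpoly) [d, d, d, d]"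
    and L: "L \<in> homog 1" and d: "d \<ge> 1"
  shows "(\<forall>t. maximal_rank J L t) \<longleftrightarrow> lefschetz_bound J (2 * d - 1) L"
proof
  assume R: "\<forall>t. maximal_rank J L t"
  show "lefschetz_bound J (2 * d - 1) L"
    unfolding lefschetz_bound_def
  proof (intro allI impI)
    fix t
    show "HF (ideal.span (insert L J)) t \<le> max 0 (hdiff 1 (HF J) t)"
    proof (cases t)
      case 0
      then show ?thesis using HF_insert_0[OF J(1) L] by (simp add: hdiff_def)
    next
      case (Suc s)
      then show ?thesis using R maximal_rank_iff[OF J(1) L, of s] by simp
    qed
  qed
next
  assume B: "lefschetz_bound J (2 * d - 1) L"
  show "\<forall>t. maximal_rank J L t"
  proof
    fix t
    show "maximal_rank J L t"
    proof (cases "t + 1 \<le> 2 * d - 1")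
      case True
      then show ?thesis
        using B max_hdiff_le_HF_insert[OF J(1) L, of "t + 1"]
        unfolding maximal_rank_iff[OF J(1) L] lefschetz_bound_def by (meson order_antisym)
    next
      case False
      \<comment> \<open>In degree \<open>2d - 1\<close> the bound makes the cokernel zero. It then
        stays zero, so the multiplication is surjective onto all later degrees.\<close>
      have "hdiff 1 (HF J) (2 * d - 1) \<le> 0"
        using hdiff_dddd_nonpos[OF fold_hdiff_1111[where 'k = 'k] d]
        unfolding J(2) CI_def fold_hdiff_snoc[symmetric] by simp
      then have "HF (ideal.span (insert L J)) (2 * d - 1) \<le> 0"
        using B unfolding lefschetz_bound_def by (metis max.absorb1 order_refl)
      then have "HF (ideal.span (insert L J)) (t + 1) = 0"
        using False by (intro HF_eq_0_mono ideal.subspace_span) auto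
      then have "dim_mod ((\<lambda>p. L * p) ` homog t) J = hilbert J (t + 1)"
        using hilbert_insert[OF J(1) L, of "t + 1"] by (simp add: HF_def)
      then show ?thesis
        using dim_mod_mult_le[OF J(1), of L t] by (simp add: maximal_rank_def)
    qed
  qed
qed

text \<open>Here \<open>e\<close> stands for the Hilbert function of \<open>A/LA\<close> and
  \<open>z\<close> for that of \<open>Z\<close>. Up to degree \<open>2d - 2\<close>,
  \<open>z\<close> has its triangular value iff \<open>e\<close> has its expected one; from
  \<open>2d - 1\<close> on, \<open>z\<close> is \<open>2d^2\<close> iff \<open>e\<close> is 0, and
  by \<open>e0\<close> the single degree \<open>2d - 1\<close> decides this.\<close>

lemma section_h_vector_iff:
  fixes e z :: "nat \<Rightarrow> int"
  defines "C \<equiv> CI TYPE((4, 'k::field) mpoly)"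
  assumes d: "d \<ge> 1" and z: "\<And>t. z t = 2 * C [1, d, d] t - e t"
    and e: "\<And>t. max 0 (C [1, d, d, d, d] t) \<le> e t"
    and e0: "\<And>t. e (2 * d - 1) \<le> 0 \<Longrightarrow> t \<ge> 2 * d - 1 \<Longrightarrow> e t = 0"
  shows "(\<forall>t \<le> 2 * d - 2. hdiff 1 z t = int t + 1) \<and> hdiff 1 z (2 * d - 1) = int d \<and>
      (\<forall>t \<ge> 2 * d. hdiff 1 z t = 0) \<longleftrightarrow>
    (\<forall>t \<le> 2 * d - 1. e t \<le> max 0 (C [1, d, d, d, d] t))"
proof -
  note h = fold_hdiff_1111[where 'k = 'k]
  have low: "2 * z t = (int t + 1) * (int t + 2) \<longleftrightarrow> e t \<le> max 0 (C [1, d, d, d, d] t)"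
    if t: "t \<le> 2 * d - 2" for t
  proof -
    have eq: "2 * (2 * C [1, d, d] t - C [1, d, d, d, d] t) = (int t + 1) * (int t + 2)"
      unfolding C_def CI_def by (rule hdiff_dd_section[OF h t d])
    have "C [1, d, d, d, d] t \<ge> 0"
      unfolding C_def CI_def by (rule hdiff_dddd_nonneg[OF h t d])
    then have "e t \<le> max 0 (C [1, d, d, d, d] t) \<longleftrightarrow> e t = C [1, d, d, d, d] t"
      using e[of t] by auto
    then show ?thesis unfolding eq[symmetric] z by auto
  qed
  have high: "z t = 2 * int d * int d \<longleftrightarrow> e t = 0" if t: "t \<ge> 2 * d - 1" for t
  proof -
    have "C [1, d, d] t = int d * int d"
      unfolding C_def CI_def by (rule hdiff_dd_degree[OF h t d])
    then show ?thesis using z[of t] by simp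
  qed
  have last: "C [1, d, d, d, d] (2 * d - 1) \<le> 0"
    unfolding C_def CI_def by (rule hdiff_dddd_nonpos[OF h d])
  have "(\<forall>t \<ge> 2 * d - 1. e t = 0) \<longleftrightarrow> e (2 * d - 1) \<le> max 0 (C [1, d, d, d, d] (2 * d - 1))"
    using e0 last by (metis max.absorb1 order_refl)
  moreover have "(\<forall>t \<le> 2 * d - 1. Q t) \<longleftrightarrow> (\<forall>t \<le> 2 * d - 2. Q t) \<and> Q (2 * d - 1)" for Q
  proof -
    have "t \<le> 2 * d - 1 \<longleftrightarrow> t \<le> 2 * d - 2 \<or> t = 2 * d - 1" for t using d by arith
    then show ?thesis by blast
  qed
  ultimately show ?thesis
    unfolding hdiff_1_iff_triangular[OF d] using low high by simp
qed

text \<open>With \<open>M\<close> added, the expected quotient is zero from degree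
  \<open>2d - 1\<close> on, so the assumed bound extends to all degrees. Removing \<open>M\<close>
  again then recovers the complete intersection and the regularity of \<open>M\<close>.\<close>

lemma plane_section:
  fixes V :: "(4, 'k::field) mpoly set"
  assumes V: "vs.subspace V" "vs.dim V = 2" "V \<subseteq> homog d" and LM: "L \<in> homog 1" "M \<in> homog 1" and d: "d \<ge> 1"
    and le: "\<And>t. t \<le> 2 * d - 1 \<Longrightarrow> HF (ideal.span ({L, M} \<union> V)) t \<le> CI TYPE((4, 'k) mpoly) [1, d, d, 1] t"
  shows "HF (ideal.span (insert L V)) = CI TYPE((4, 'k) mpoly) [1, d, d]"
    and "regular_on M (ideal.span (insert L V))"
proof -
  obtain B where B: "B \<subseteq> V" "\<not> vs.dependent B" "V \<subseteq> vs.span B" "card B = vs.dim V"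
    by (rule vs.basis_exists)
  obtain g1 g2 where g: "B = {g1, g2}" using B(4) V(2) by (auto simp: card_2_iff)
  have Vs: "V = vs.span {g1, g2}"
    using B V(1) vs.span_minimal unfolding g by blast
  have LV: "ideal.span (insert L V) = ideal.span (set [L, g1, g2])"
    using ideal_span_insert_vs_span[of "{L}" "{g1, g2}"] unfolding Vs by (simp add: insert_commute)
  have LMV: "ideal.span ({L, M} \<union> V) = ideal.span (set ([L, g1, g2] @ [M]))"
    using ideal_span_insert_vs_span[of "{L, M}" "{g1, g2}"] unfolding Vs by (simp add: insert_commute)
  have gd: "g1 \<in> homog d" "g2 \<in> homog d" using B(1) V(3) g by auto
  have "CI TYPE((4, 'k) mpoly) [1, d, d, 1] = CI TYPE((4, 'k) mpoly) [1, 1, d, d]"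
    using CI_rotate[where 'i = 4 and 'k = 'k, of 1 "[1, d, d]"] by simp
  then have zero: "CI TYPE((4, 'k) mpoly) [1, d, d, 1] t = 0" if "t \<ge> 2 * d - 1" for t
    using hdiff_dd_plane_eq_0[OF fold_hdiff_1111[where 'k = 'k] d that] by (simp add: CI_def)
  have all: "HF (ideal.span (set ([L, g1, g2] @ [M]))) t \<le> CI TYPE((4, 'k) mpoly) ([1, d, d] @ [1]) t" for t
  proof (cases "t \<le> 2 * d - 1")
    case True
    then show ?thesis using le LMV by simp
  next
    case False
    have "HF (ideal.span (set ([L, g1, g2] @ [M]))) (2 * d - 1) \<le> 0"
      using le[of "2 * d - 1"] LMV zero[of "2 * d - 1"] by simp
    then have "HF (ideal.span (set ([L, g1, g2] @ [M]))) t = 0"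
      using False by (intro HF_eq_0_mono ideal.subspace_span) auto
    then show ?thesis using zero[of t] False by simp
  qed
  have forms: "forms_of_degrees [L, g1, g2] [1, d, d]" "\<forall>d\<in>set [1, d, d]. d > 0"
    using LM gd d by simp_all
  show "HF (ideal.span (insert L V)) = CI TYPE((4, 'k) mpoly) [1, d, d]"
    unfolding LV by (rule last_regular_on(1)[OF forms LM(2) zero_less_one all])
  show "regular_on M (ideal.span (insert L V))"
    unfolding LV by (rule last_regular_on(2)[OF forms LM(2) zero_less_one all])
qed

section \<open>Openness of the conditions on a triple\<close>

lemma zariski_open_lefschetz_bound:
  fixes f :: "4 \<Rightarrow> (4, 'k::field_char_0) mpoly" and l :: "4 \<Rightarrow> ('j::finite \<Rightarrow> 'k) \<Rightarrow> 'k"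
  assumes f: "\<And>i. f i \<in> homog d" and l: "\<And>i. polyfun (l i)"
  shows "zariski_open {a. lefschetz_bound (ideal.span (range f)) n (linear_form (\<lambda>i. l i a))}"
proof -
  \<comment> \<open>\<open>None\<close> indexes the variable linear form, and \<open>Some i\<close>
    the generators of the ideal, which are constant in the parameter.\<close>
  let ?g = "\<lambda>x a. case x of None \<Rightarrow> linear_form (\<lambda>i. l i a) | Some i \<Rightarrow> f i"
  let ?e = "\<lambda>x. case x of None \<Rightarrow> 1 | Some (i :: 4) \<Rightarrow> d"
  have "ideal.span (insert (linear_form (\<lambda>i. l i a)) (ideal.span (range f))) =
      ideal.span ((\<lambda>x. ?g x a) ` UNIV)" for a
    unfolding ideal_span_insert_span UNIV_option_conv by (simp add: image_comp)
  then have eq: "{a. lefschetz_bound (ideal.span (range f)) n (linear_form (\<lambda>i. l i a))} =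
      {a. \<forall>t\<in>{..n}. HF (ideal.span ((\<lambda>x. ?g x a) ` UNIV)) t \<le> max 0 (hdiff 1 (HF (ideal.span (range f))) t)}"
    by (auto simp: lefschetz_bound_def)
  show ?thesis
    unfolding eq
  proof (rule zariski_open_all)
    fix t
    show "zariski_open {a. HF (ideal.span ((\<lambda>x. ?g x a) ` UNIV)) t \<le> max 0 (hdiff 1 (HF (ideal.span (range f))) t)}"
    proof (rule zariski_open_HF_le)
      fix x :: "4 option" and m
      show "polyfun (\<lambda>a. lookup (?g x a) m)"
        by (cases x) (simp_all add: polyfun_linear_form[OF l] polyfun_const)
      fix a :: "'j \<Rightarrow> 'k"
      show "?g x a \<in> homog (?e x)"
        using f homog_linear_form[unfolded One_nat_def] by (cases x) auto
    qed simp
  qed simp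
qed

lemma zariski_open_plane_section:
  fixes f :: "4 \<Rightarrow> (4, 'k::field_char_0) mpoly"
  assumes f: "\<And>i. f i \<in> homog d" and M: "M \<in> homog 1"
  shows "zariski_open {a. \<forall>t\<in>{..n}. HF (ideal.span ({linear_form (\<lambda>i. a (Inr i)), M} \<union>
    {frame_form f a j, frame_form f a k})) t \<le> C t}"
proof (rule zariski_open_all)
  \<comment> \<open>The type \<open>4\<close> serves here as an index set for the four generators,
    not for the variables.\<close>
  let ?g = "\<lambda>x a. if x = (0 :: 4) then linear_form (\<lambda>i. a (Inr i)) else if x = 1 then M
    else if x = 2 then frame_form f a j else frame_form f a k"
  have im: "{linear_form (\<lambda>i. a (Inr i)), M} \<union> {frame_form f a j, frame_form f a k} = (\<lambda>x. ?g x a) ` UNIV" for a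
    unfolding UNIV_4_list(1) by auto
  fix t
  show "zariski_open {a. HF (ideal.span ({linear_form (\<lambda>i. a (Inr i)), M} \<union>
      {frame_form f a j, frame_form f a k})) t \<le> C t}"
    unfolding im
  proof (rule zariski_open_HF_le)
    fix x :: 4 and m
    show "polyfun (\<lambda>a. lookup (?g x a) m)"
      by (cases "x = 0"; cases "x = 1"; cases "x = 2")
        (simp_all add: polyfun_linear_form polyfun_coord polyfun_const polyfun_frame_form)
    fix a :: "4 \<times> 4 + 4 \<Rightarrow> 'k"
    have "frame_form f a j \<in> homog d" for j
      unfolding frame_form_def
      by (intro vs.subspace_sum[OF subspace_homog] vs.subspace_scale[OF subspace_homog] f)
    then show "?g x a \<in> homog (if x = 0 \<or> x = 1 then 1 else d)"
      using M homog_linear_form by auto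
  qed simp
qed simp

text \<open>In degree \<open>d\<close> the ideal consists of the scalar combinations of the
  \<open>f i\<close>, while a complete intersection loses exactly \<open>4 * HF {0} 0 = 4\<close>
  dimensions in that degree.\<close>

lemma dim_span_regular_sequence:
  fixes f :: "4 \<Rightarrow> (4, 'k::field) mpoly"
  assumes f: "\<And>i. f i \<in> homog d" and d: "d \<ge> 1"
    and HF: "HF (ideal.span (range f)) = CI TYPE((4, 'k) mpoly) [d, d, d, d]"
  shows "vs.dim (vs.span (range f)) = 4"
proof -
  let ?h = "HF ({0} :: (4, 'k) mpoly set)"
  have "{single m 1 * f x | m x. x \<in> UNIV \<and> mdeg m + d = d} = range f"
  proof -
    have "m = 0" if "mdeg m = 0" for m :: "4 \<Rightarrow>\<^sub>0 nat"
      using that by (intro poly_mapping_eqI) (simp add: mdeg_def)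
    then have iff: "mdeg m + d = d \<longleftrightarrow> m = 0" for m :: "4 \<Rightarrow>\<^sub>0 nat" by auto
    show ?thesis unfolding iff by auto
  qed
  then have "homog d \<inter> ideal.span (range f) = vs.span (range f)"
    using ideal_span_piece[of UNIV f "\<lambda>_. d" d] f by (simp add: Int_commute)
  then have "int (vs.dim (vs.span (range f))) = int (vs.dim (homog d :: (4, 'k) mpoly set)) - HF (ideal.span (range f)) d"
    by (simp add: HF_def int_hilbert)
  moreover have "?h d = int (vs.dim (homog d :: (4, 'k) mpoly set))"
  proof -
    have "homog d \<inter> {0 :: (4, 'k) mpoly} = {0}" by auto
    moreover have "vs.dim {0 :: (4, 'k) mpoly} = 0" using vs.dim_le_card[of "{0}" "{}"] by simp
    ultimately show ?thesis by (simp add: HF_def int_hilbert)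
  qed
  moreover have "fold hdiff [d, d, d, d] ?h d = ?h d - 4 * ?h 0"
    using d by (simp add: hdiff_def)
  moreover have "?h 0 = 1" using hdiff_0[OF fold_hdiff_1111[where 'k = 'k], of 0] by simp
  ultimately show ?thesis unfolding HF CI_def by simp
qed

text \<open>One rank condition on all four rows makes both frames nondegenerate, so the two
  Grassmannian conditions on a triple add no further equations.\<close>

lemma dim_span_two_planes:
  fixes x0 x1 x2 x3 :: "('i, 'k::field) mpoly"
  assumes "4 \<le> vs.dim (vs.span {x0, x1, x2, x3})"
  shows "vs.dim (vs.span {x0, x1}) = 2" "vs.dim (vs.span {x2, x3}) = 2"
proof -
  have le: "vs.dim (vs.span {x, y}) \<le> 2" for x y :: "('i, 'k) mpoly"
    using vs.dim_le_card[of "vs.span {x, y}" "{x, y}"] card_insert_le_m1[of 2 "{y}" x] by simp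
  have fd: "vs.fin_dim (vs.span {x, y})" for x y :: "('i, 'k) mpoly"
    unfolding vs.fin_dim_def by (intro exI[of _ "{x, y}"]) simp
  have "{x0, x1, x2, x3} = {x0, x1} \<union> {x2, x3}" by auto
  then have "vs.span {x0, x1, x2, x3} = {x + y | x y. x \<in> vs.span {x0, x1} \<and> y \<in> vs.span {x2, x3}}"
    using vs.span_Un[of "{x0, x1}" "{x2, x3}"] by simp
  then have "vs.dim (vs.span {x0, x1, x2, x3}) \<le> vs.dim (vs.span {x0, x1}) + vs.dim (vs.span {x2, x3})"
    using vs.dim_sums_Int[OF vs.subspace_span fd vs.subspace_span fd, of x0 x1 x2 x3] by simp
  then show "vs.dim (vs.span {x0, x1}) = 2" "vs.dim (vs.span {x2, x3}) = 2"
    using assms le[of x0 x1] le[of x2 x3] by simp_all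
qed

lemma span_span_Un: "vs.span (vs.span A \<union> vs.span B) = vs.span (A \<union> B)"
proof (rule subset_antisym)
  have "vs.span A \<subseteq> vs.span (A \<union> B)" "vs.span B \<subseteq> vs.span (A \<union> B)"
    by (intro vs.span_mono, simp)+
  then show "vs.span (vs.span A \<union> vs.span B) \<subseteq> vs.span (A \<union> B)"
    by (intro vs.span_minimal vs.subspace_span) simp
  show "vs.span (A \<union> B) \<subseteq> vs.span (vs.span A \<union> vs.span B)"
    by (intro vs.span_mono Un_mono vs.span_superset)
qed

lemma range_4: "range (g :: 4 \<Rightarrow> 'a) = {g 0, g 1, g 2, g 3}"
  unfolding UNIV_4_list(1) by simp

lemma h_vector_eq_hdiff: "h_vector J t = hdiff 1 (HF J) t"
  by (simp add: h_vector_def hdiff_def HF_def)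

theorem lemma4p2:
  fixes f :: "4 \<Rightarrow> (4, 'k::{alg_closed_field, field_char_0}) mpoly"
    and I :: "(4, 'k) mpoly set"
    and d :: nat
  assumes "d \<ge> 2"
    and "\<And>i. f i \<in> homog d"
    and "regular_sequence [f 0, f 1, f 2, f 3]"
    and "I = ideal.span (range f)"
  shows "\<exists>U. U \<subseteq> grassmannian 2 (I \<inter> homog d) \<times> grassmannian 2 (I \<inter> homog d) \<times> (homog 1 - {0}) \<and>
             U \<noteq> {} \<and> zariski_open_triples f U \<and>
             (\<forall>(V1, V2, L)\<in>U.
                weak_lefschetz I \<longleftrightarrow>
                  (\<forall>t \<le> 2 * d - 2. h_vector (section_ideal V1 V2 L) t = int t + 1) \<and>
                  h_vector (section_ideal V1 V2 L) (2 * d - 1) = int d \<and>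
                  (\<forall>t \<ge> 2 * d. h_vector (section_ideal V1 V2 L) t = 0))"
proof -
  note f = assms(2) and I = assms(4)
  have d: "d \<ge> 1" using assms(1) by simp
  have HFI: "HF I = CI TYPE((4, 'k) mpoly) [d, d, d, d]"
    using HF_regular_sequence[OF _ assms(3), of "[d, d, d, d]"] f by (simp add: I range_4)
  have homI: "homogeneous_ideal I"
    unfolding I by (rule homogeneous_ideal_span) (use f in blast)
  have "HF I (4 * d) = 0"
    unfolding HFI CI_def by (rule hdiff_dddd_eq_0[OF fold_hdiff_1111]) simp
  then have N: "homog (4 * d) \<subseteq> I"
    using hilbert_eq_0_iff[OF homogeneous_ideal_vs[OF homI]] by (simp add: HF_def)
  \<comment> \<open>This choice fits the witness in \<open>S3_ne\<close>, where \<open>L\<close> is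
    \<open>x_0\<close>: killing \<open>L\<close> and \<open>M\<close> then restricts to the line
    \<open>x_0 = x_1 = 0\<close>.\<close>
  define M :: "(4, 'k) mpoly" where "M = var 1"
  have M: "M \<in> homog 1" unfolding M_def by (rule homog_var)
  let ?T = "vs.span (range f)"
  have T: "vs.dim ?T = 4" using dim_span_regular_sequence[OF f d] HFI I by simp
  have Tfd: "vs.fin_dim ?T" unfolding vs.fin_dim_def by (intro exI[of _ "range f"]) simp
  have TI: "?T \<subseteq> I \<inter> homog d"
    by (intro vs.span_minimal vs.subspace_inter subspace_homog homogeneous_ideal_vs homI)
      (use f in \<open>auto simp: I intro: ideal.span_base\<close>)

  define sect where "sect G L \<longleftrightarrow>
    (\<forall>t\<in>{..2 * d - 1}. HF (ideal.span ({L, M} \<union> G)) t \<le> CI TYPE((4, 'k) mpoly) [1, d, d, 1] t)" for G L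
  have sect_span: "sect (vs.span G) L \<longleftrightarrow> sect G L" for G L
    unfolding sect_def ideal_span_insert_vs_span ..
  \<comment> \<open>Writing \<open>range linear_form\<close> supplies a coefficient vector for
    \<open>L\<close>, to which \<open>wlp\<close> below applies.\<close>
  define U where "U = {(V1, V2, L). V1 \<in> grassmannian 2 ?T \<and> V2 \<in> grassmannian 2 ?T \<and>
    L \<in> range linear_form - {0} \<and> 4 \<le> vs.dim (vs.span (V1 \<union> V2)) \<and> sect V1 L \<and> sect V2 L \<and>
    (weak_lefschetz I \<longrightarrow> lefschetz_bound I (2 * d - 1) L)}"

  have lefschetz_open: "zariski_open {l. lefschetz_bound I (2 * d - 1) (linear_form l)}"
    using zariski_open_lefschetz_bound[OF f, where l = "\<lambda>i a. a i"] by (simp add: I polyfun_coord)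
  \<comment> \<open>The definition asks for a nonempty open set of linear forms; as the bound is an
    open condition, a single form attaining it is enough.\<close>
  have wlp: "weak_lefschetz I \<longleftrightarrow> (\<exists>l. lefschetz_bound I (2 * d - 1) (linear_form l))"
  proof
    assume "weak_lefschetz I"
    then obtain W :: "(4 \<Rightarrow> 'k) set" where "W \<noteq> {}" "\<forall>l\<in>W. \<forall>t. maximal_rank I (linear_form l) t"
      unfolding weak_lefschetz_def by blast
    then show "\<exists>l. lefschetz_bound I (2 * d - 1) (linear_form l)"
      using all_maximal_rank_iff[OF homI HFI homog_linear_form d] by blast
  next
    assume "\<exists>l. lefschetz_bound I (2 * d - 1) (linear_form l)"
    then show "weak_lefschetz I"
      unfolding weak_lefschetz_def
      using lefschetz_open all_maximal_rank_iff[OF homI HFI homog_linear_form d]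
      by (intro exI[of _ "{l. lefschetz_bound I (2 * d - 1) (linear_form l)}"]) blast
  qed

  let ?l = "\<lambda>a :: 4 \<times> 4 + 4 \<Rightarrow> 'k. linear_form (\<lambda>i. a (Inr i))"
  let ?fr = "frame_form f"
  define S1 where "S1 = {a. 4 \<le> vs.dim (vs.span ((\<lambda>j. ?fr a j) ` UNIV))}"
  \<comment> \<open>The condition that \<open>L\<close> is nonzero, phrased as a rank condition so
    that \<open>zariski_open_dim_span_ge\<close> applies.\<close>
  define S2 where "S2 = {a. 1 \<le> vs.dim (vs.span ((\<lambda>_. ?l a) ` {()}))}"
  define S3 where "S3 j k = {a. sect {?fr a j, ?fr a k} (?l a)}" for j k
  define S4 where "S4 = {a. weak_lefschetz I \<longrightarrow> lefschetz_bound I (2 * d - 1) (?l a)}"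
  have S2_iff: "a \<in> S2 \<longleftrightarrow> ?l a \<noteq> 0" for a
  proof (cases "?l a = 0")
    case True
    then show ?thesis using vs.dim_le_card[of "{0 :: (4, 'k) mpoly}" "{}"] by (simp add: S2_def)
  next
    case False
    then show ?thesis
      using vs.dim_eq_card_independent[of "{?l a}"] by (simp add: S2_def)
  qed

  have fr_T: "?fr a j \<in> ?T" for a j
    unfolding frame_form_def by (intro vs.span_sum vs.span_scale vs.span_base) simp
  have pre: "{a. triple_of f a \<in> U} = S1 \<inter> S2 \<inter> S3 0 1 \<inter> S3 2 3 \<inter> S4"
  proof -
    have S1_iff: "a \<in> S1 \<longleftrightarrow> 4 \<le> vs.dim (vs.span (vs.span {?fr a 0, ?fr a 1} \<union> vs.span {?fr a 2, ?fr a 3}))" for a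
      unfolding S1_def span_span_Un range_4 by (simp add: insert_commute)
    have gr: "vs.span {?fr a 0, ?fr a 1} \<in> grassmannian 2 ?T \<and> vs.span {?fr a 2, ?fr a 3} \<in> grassmannian 2 ?T"
      if "a \<in> S1" for a
    proof -
      have "4 \<le> vs.dim (vs.span {?fr a 0, ?fr a 1, ?fr a 2, ?fr a 3})"
        using that unfolding S1_def range_4 by simp
      note dims = dim_span_two_planes[OF this]
      have "vs.span {?fr a j, ?fr a k} \<subseteq> ?T" for j k
        by (intro vs.span_minimal vs.subspace_span) (use fr_T in blast)
      then show ?thesis using dims unfolding grassmannian_def by simp
    qed
    show ?thesis
      using S1_iff gr S2_iff
      by (auto simp: U_def triple_of_def sect_span S3_def S4_def)
  qed

  have S1_open: "zariski_open S1"
    unfolding S1_def by (rule zariski_open_dim_span_ge) (simp_all add: polyfun_frame_form)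
  have S2_open: "zariski_open S2"
    unfolding S2_def
    by (rule zariski_open_dim_span_ge) (simp_all add: polyfun_linear_form polyfun_coord)
  have S3_open: "zariski_open (S3 j k)" for j k
    unfolding S3_def sect_def by (rule zariski_open_plane_section[OF f M])
  have S4_open: "zariski_open S4"
  proof (cases "weak_lefschetz I")
    case True
    then show ?thesis
      using zariski_open_lefschetz_bound[OF f, where l = "\<lambda>i a. a (Inr i)"]
      by (simp add: S4_def I polyfun_coord)
  qed (simp add: S4_def zariski_open_UNIV)

  have delta: "(\<Sum>i\<in>UNIV. smul (if i = j then 1 else 0) (f i)) = f j" for j
  proof -
    have "(\<Sum>i\<in>UNIV. smul (if i = j then 1 else 0) (f i)) = (\<Sum>i\<in>UNIV. if i = j then f i else 0)"
      by (intro sum.cong) auto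
    then show ?thesis by simp
  qed
  have S1_ne: "S1 \<noteq> {}"
  proof -
    define a :: "4 \<times> 4 + 4 \<Rightarrow> 'k" where
      "a = (\<lambda>x. case x of Inl (j, i) \<Rightarrow> if i = j then 1 else 0 | Inr i \<Rightarrow> 0)"
    have "?fr a j = f j" for j unfolding frame_form_def a_def by (simp add: delta)
    then have "a \<in> S1" using T by (simp add: S1_def)
    then show ?thesis by blast
  qed
  have var_0: "(var 0 :: (4, 'k) mpoly) \<noteq> 0"
    unfolding var_def by (metis lookup_single_eq lookup_zero zero_neq_one)
  have S2_ne: "S2 \<noteq> {}"
  proof -
    have "(\<lambda>x. case x of Inl _ \<Rightarrow> 0 | Inr i \<Rightarrow> if i = 0 then 1 else 0) \<in> S2"
      unfolding S2_iff using var_0 by (simp add: linear_form_delta)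
    then show ?thesis by blast
  qed
  have S3_ne: "S3 j k \<noteq> {}" if "j \<noteq> k" for j k
  proof -
    obtain i c where ic: "HF (ideal.span {var 0, var 1, f i, \<Sum>j\<in>UNIV. smul (c j) (f j)}) =
        CI TYPE((4, 'k) mpoly) [1, 1, d, d]"
      using exists_line_section[OF f d N[unfolded I]] by blast
    define a :: "4 \<times> 4 + 4 \<Rightarrow> 'k" where
      "a = (\<lambda>x. case x of Inl (r, s) \<Rightarrow> if r = j then (if s = i then 1 else 0) else c s
        | Inr s \<Rightarrow> if s = 0 then 1 else 0)"
    have "?fr a j = f i" "?fr a k = (\<Sum>j\<in>UNIV. smul (c j) (f j))" "?l a = var 0"
      unfolding frame_form_def a_def using that by (simp_all add: delta linear_form_delta)
    moreover have "CI TYPE((4, 'k) mpoly) [1, d, d, 1] = CI TYPE((4, 'k) mpoly) [1, 1, d, d]"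
      using CI_rotate[where 'i = 4 and 'k = 'k, of 1 "[1, d, d]"] by simp
    ultimately have "a \<in> S3 j k"
      using ic by (simp add: S3_def sect_def M_def insert_commute)
    then show ?thesis by blast
  qed
  have S4_ne: "S4 \<noteq> {}"
  proof (cases "weak_lefschetz I")
    case True
    then obtain l where "lefschetz_bound I (2 * d - 1) (linear_form l)" using wlp by blast
    then have "case_sum (\<lambda>_. 0) l \<in> S4" by (simp add: S4_def)
    then show ?thesis by blast
  qed (simp add: S4_def)
  have pre_open: "zariski_open {a. triple_of f a \<in> U}"
    unfolding pre by (intro zariski_open_Int S1_open S2_open S3_open S4_open)
  \<comment> \<open>The witnesses found above are unrelated to each other; irreducibility of the
    affine space of frames and linear forms provides a common point.\<close>
  have "{a. triple_of f a \<in> U} \<noteq> {}"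
    unfolding pre
    by (intro zariski_open_irreducible zariski_open_Int S1_open S2_open S3_open S4_open
        S1_ne S2_ne S3_ne S4_ne) simp_all
  then have U_ne: "U \<noteq> {}" by blast

  have equivalence: "weak_lefschetz I \<longleftrightarrow>
      (\<forall>t \<le> 2 * d - 2. h_vector (section_ideal V1 V2 L) t = int t + 1) \<and>
      h_vector (section_ideal V1 V2 L) (2 * d - 1) = int d \<and>
      (\<forall>t \<ge> 2 * d. h_vector (section_ideal V1 V2 L) t = 0)"
    if "(V1, V2, L) \<in> U" for V1 V2 L
  proof -
    have V1: "vs.subspace V1" "vs.dim V1 = 2" "V1 \<subseteq> ?T" and V2: "vs.subspace V2" "vs.dim V2 = 2" "V2 \<subseteq> ?T"
      and dim: "4 \<le> vs.dim (vs.span (V1 \<union> V2))" and s: "sect V1 L" "sect V2 L"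
      and WL: "weak_lefschetz I \<longrightarrow> lefschetz_bound I (2 * d - 1) L"
      using that by (auto simp: U_def grassmannian_def)
    have "L \<in> range linear_form" using that by (simp add: U_def)
    then obtain l where l: "L = linear_form l" by blast
    have L: "L \<in> homog 1" unfolding l by (rule homog_linear_form)
    have Vd: "V1 \<subseteq> homog d" "V2 \<subseteq> homog d" using V1(3) V2(3) TI by blast+
    have "vs.span (V1 \<union> V2) \<subseteq> ?T"
      by (intro vs.span_minimal vs.subspace_span Un_least V1(3) V2(3))
    then have "vs.span (V1 \<union> V2) = ?T"
      by (rule vs.subspace_eqI[OF Tfd vs.subspace_span]) (use dim T in simp)
    moreover have "vs.span (V1 \<union> V2) \<subseteq> ideal.span (V1 \<union> V2)"
      by (intro vs.span_minimal vs_subspace_ideal ideal.subspace_span ideal.span_superset)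
    ultimately have "range f \<subseteq> ideal.span (V1 \<union> V2)"
      using vs.span_superset[of "range f"] by simp
    then have "I \<subseteq> ideal.span (V1 \<union> V2)"
      unfolding I by (intro ideal.span_minimal ideal.subspace_span)
    moreover have "ideal.span (V1 \<union> V2) \<subseteq> I"
      by (intro ideal.span_minimal homogeneous_ideal_ideal[OF homI] Un_least) (use V1(3) V2(3) TI in blast)+
    ultimately have IV: "I = ideal.span (V1 \<union> V2)" by blast
    have P1: "HF (ideal.span (insert L V1)) = CI TYPE((4, 'k) mpoly) [1, d, d]" "regular_on M (ideal.span (insert L V1))"
      using plane_section[OF V1(1,2) Vd(1) L M d] s(1) unfolding sect_def by auto
    have P2: "HF (ideal.span (insert L V2)) = CI TYPE((4, 'k) mpoly) [1, d, d]" "regular_on M (ideal.span (insert L V2))"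
      using plane_section[OF V2(1,2) Vd(2) L M d] s(2) unfolding sect_def by auto
    let ?e = "HF (ideal.span (insert L I))"
    have z: "HF (section_ideal V1 V2 L) t = 2 * CI TYPE((4, 'k) mpoly) [1, d, d] t - ?e t" for t
      using HF_section_ideal[OF M P1(2) P2(2) N[unfolded IV] Vd L, of t]
      by (simp add: P1(1) P2(1) IV ideal_span_insert_span)
    have h1: "hdiff 1 (HF I) = CI TYPE((4, 'k) mpoly) [1, d, d, d, d]"
      unfolding HFI CI_rotate[of 1] CI_snoc ..
    have "(\<forall>t \<le> 2 * d - 2. h_vector (section_ideal V1 V2 L) t = int t + 1) \<and>
        h_vector (section_ideal V1 V2 L) (2 * d - 1) = int d \<and>
        (\<forall>t \<ge> 2 * d. h_vector (section_ideal V1 V2 L) t = 0) \<longleftrightarrow> lefschetz_bound I (2 * d - 1) L"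
      unfolding h_vector_eq_hdiff lefschetz_bound_def h1
      by (rule section_h_vector_iff[OF d z])
        (use max_hdiff_le_HF_insert[OF homI L] h1 HF_eq_0_mono[OF ideal.subspace_span] in auto)
    \<comment> \<open>If the property holds, membership in \<open>U\<close> supplies the bound at
      this \<open>L\<close>; if the bound holds at this \<open>L\<close>, then \<open>wlp\<close>
      gives the property.\<close>
    then show ?thesis using WL wlp l by blast
  qed

  have T_gr: "V \<in> grassmannian 2 (I \<inter> homog d)" if "V \<in> grassmannian 2 ?T" for V
    using that TI unfolding grassmannian_def by blast
  have "U \<subseteq> grassmannian 2 ?T \<times> grassmannian 2 ?T \<times> (homog 1 - {0})"
    using homog_linear_form by (auto simp: U_def)
  moreover from this have "U \<subseteq> grassmannian 2 (I \<inter> homog d) \<times> grassmannian 2 (I \<inter> homog d) \<times> (homog 1 - {0})"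
    using T_gr by blast
  ultimately show ?thesis
    using U_ne pre_open equivalence unfolding zariski_open_triples_def by (intro exI[of _ U]) auto
qed

end
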